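(* Let $z\in\mathbb{C}\setminus(-\infty,0]$. Then $$\int_0^\infty \frac{c^2}{(1+c^2)^2}\,J_1(cz)\,dc=\frac{z}{2}\,K_0(z).$$
   Context: $J_\nu:\mathbb{C}\setminus(-\infty,0]\to\mathbb{C}$ is the Bessel function of the first kind and $K_\nu:\mathbb{C}\setminus(-\infty,0]\to\mathbb{C}$ is the modified Bessel function of the second kind, of order $\nu$.
   Formalization: For non-real z the integral diverges, so the equation is stated where the integral converges (shown absolutely for z>0), and for all z in the slit plane (z/2)K_0(z) is stated to be the value of the analytic continuation of the integral from z>0. *)

theory Defs
  imports "HOL-Analysis.Analysis"
begin

(* Principal branches throughout. The factor (-1) ^ k / (fact k * Gamma (\<nu> + k + 1)) of the
   defining series is written with rGamma = 1 / Gamma, which is entire, so that terms at poles of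
   Gamma vanish, as required for negative integer orders. *)

definition bessel_J :: "complex \<Rightarrow> complex \<Rightarrow> complex" where
  "bessel_J \<nu> z = (z / 2) powr \<nu> *
     (\<Sum>k. (-1) ^ k * rGamma (\<nu> + of_nat k + 1) / fact k * (z / 2) ^ (2 * k))"

definition bessel_I :: "complex \<Rightarrow> complex \<Rightarrow> complex" where
  "bessel_I \<nu> z = (z / 2) powr \<nu> *
     (\<Sum>k. rGamma (\<nu> + of_nat k + 1) / fact k * (z / 2) ^ (2 * k))"

definition bessel_K_quot :: "complex \<Rightarrow> complex \<Rightarrow> complex" where
  "bessel_K_quot \<nu> z =
     of_real pi / 2 * (bessel_I (- \<nu>) z - bessel_I \<nu> z) / sin (of_real pi * \<nu>)"

(* At integer orders the quotient is 0 / 0 and K is its limit in the order. *)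

definition bessel_K :: "complex \<Rightarrow> complex \<Rightarrow> complex" where
  "bessel_K \<nu> z =
     (if \<nu> \<in> \<int> then Lim (at \<nu>) (\<lambda>\<mu>. bessel_K_quot \<mu> z) else bessel_K_quot \<nu> z)"

(* For z off the real axis, bessel_J 1 (c * z) grows like exp (c * \<bar>Im z\<bar>) / sqrt c as c tends to
   infinity, so this function of c has a convergent integral over {0..} only for real z. *)

definition bessel_integrand :: "complex \<Rightarrow> real \<Rightarrow> complex" where
  "bessel_integrand z c = of_real (c\<^sup>2 / (1 + c\<^sup>2)\<^sup>2) * bessel_J 1 (of_real c * z)"

end

theory Submission
  imports Defs "HOL-Complex_Analysis.Complex_Analysis" "HOL-Real_Asymp.Real_Asymp"
begin

text \<open>
  For real \<open>z = x > 0\<close> put \<open>s = c\<^sup>2\<close> and \<open>y = x\<^sup>2 / 4\<close>, write \<open>1 / (1 + s)\<^sup>2\<close> as the Laplace transform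
  \<open>\<integral> t exp (- t (1 + s)) dt\<close> and exchange the integrals; the inner one is a Weber integral, and what is
  left is \<open>x / 4\<close> times \<open>M y = \<integral> exp (- t - y / t) / t dt\<close>. Both \<open>M\<close> and the logarithmic series of
  \<open>2 K\<^sub>0 (x)\<close> (minus twice the derivative in the order of \<open>I\<^sub>\<mu>\<close> at \<open>\<mu> = 0\<close>) solve \<open>(y f')' = f\<close>, and they
  have the same expansion \<open>- ln y - 2 \<gamma> + o(1)\<close> at \<open>0\<close>, so they agree by a Wronskian argument.
  For non-real \<open>z\<close> the integral diverges: the imaginary part of \<open>c J\<^sub>1(cz) cnj (J\<^sub>0(cz))\<close> grows exponentially
  in \<open>c\<close>, whereas convergence would force polynomial growth. The analytic continuation asked for
  is then \<open>z / 2 * K\<^sub>0 (z)\<close> itself.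
\<close>

section \<open>Bessel functions of order 0 and 1\<close>

text \<open>In the variable y = (u / 2)^2 every Bessel function involved is an elementary factor
  times the entire Bessel-Clifford function \<open>bessel_series m\<close>, with I_m(u) = (u / 2)^m
  \<open>bessel_series m y\<close> and J_m(u) the same at - y. Differentiation only raises m, and
  real and complex arguments share one definition. The integral cannot be evaluated term by term,
  since every power of s that occurs diverges against 1 / (1 + s)^2. Against exp (- t s) the powers
  are Gamma moments, which is what the Laplace transform buys; the exchange of integrals then rests
  on |J_1| <= 1 on the positive axis, and no asymptotics at infinity are needed. The equation (y
  f')' = f has a two-dimensional solution space, so the expansion at 0 has to be known up to o(1):
  this excludes both the logarithmic solution and multiples of I_0. The constant in it comes from
  the derivative of Gamma at 1. For the divergence, \<open>integrable_on\<close> is the gauge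
  integral and admits conditional convergence, so large values of the integrand alone would prove
  nothing; the argument works with the primitive instead.\<close>

definition bessel_series :: "nat \<Rightarrow> 'a::{real_normed_field,banach} \<Rightarrow> 'a" where
  "bessel_series m y = (\<Sum>k. 1 / (fact k * fact (k + m)) * y ^ k)"

lemma summable_bessel_series:
  fixes y :: "'a::{real_normed_field,banach}"
  shows "summable (\<lambda>k. 1 / (fact k * fact (k + m)) * y ^ k)"
proof (rule summable_comparison_test'[OF summable_norm_exp[of y], of 0])
  fix k :: nat
  have "1 \<le> (fact (k + m) :: real)"
    using fact_ge_1 by blast
  then show "norm (1 / (fact k * fact (k + m)) * y ^ k) \<le> norm (inverse (fact k) *\<^sub>R y ^ k)"
    by (simp add: norm_mult norm_divide norm_power divide_simps mult_le_cancel_left1)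
qed

lemma bessel_series_0 [simp]: "bessel_series m 0 = 1 / fact m"
  unfolding bessel_series_def by (subst suminf_finite[of "{0}"]) auto

lemma bessel_series_of_real:
  "bessel_series m (of_real y :: 'a::{real_normed_field,banach}) = of_real (bessel_series m y)"
  unfolding bessel_series_def by (subst suminf_of_real[OF summable_bessel_series]) simp

lemma has_field_derivative_bessel_series:
  "(bessel_series m has_field_derivative bessel_series (Suc m) y) (at y)"
proof -
  have "diffs (\<lambda>k. 1 / (fact k * fact (k + m)) :: 'a) = (\<lambda>k. 1 / (fact k * fact (k + Suc m)))"
    by (auto simp: diffs_def fun_eq_iff field_simps simp del: of_nat_Suc)
  then show ?thesis
    using termdiffs_strong_converges_everywhere[OF summable_bessel_series, of m y]
    by (simp add: bessel_series_def[abs_def])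
qed

lemmas has_field_derivative_bessel_series' [derivative_intros] =
  DERIV_chain2[OF has_field_derivative_bessel_series]

lemma continuous_on_bessel_series [continuous_intros]:
  "continuous_on A f \<Longrightarrow> continuous_on A (\<lambda>x. bessel_series m (f x))"
  using continuous_on_compose2[of UNIV "bessel_series m" A f] DERIV_isCont[OF has_field_derivative_bessel_series]
  by (auto intro: continuous_at_imp_continuous_on)

text \<open>Since differentiation raises the index, this is the differential equation f = (m + 1) f'
  + y f''; for m = 0 it reads f = (y f')'. On coefficients it says that (m + 1) + k cancels the last
  factor of (k + m + 1)!.\<close>

lemma bessel_series_recurrence:
  fixes y :: "'a::{real_normed_field,banach}"
  shows "bessel_series m y = of_nat (Suc m) * bessel_series (Suc m) y + y * bessel_series (Suc (Suc m)) y"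
proof -
  let ?c = "\<lambda>m k. 1 / (fact k * fact (k + m)) :: 'a"
  have s: "(\<lambda>k. ?c m k * y ^ k) sums bessel_series m y" for m
    unfolding bessel_series_def by (rule summable_sums[OF summable_bessel_series])
  have "(\<lambda>k. y * (?c (Suc (Suc m)) k * y ^ k)) sums (y * bessel_series (Suc (Suc m)) y)"
    by (intro sums_mult s)
  moreover have "y * (?c (Suc (Suc m)) k * y ^ k) = of_nat (Suc k) * ?c (Suc m) (Suc k) * y ^ Suc k" for k
    by (simp add: divide_simps del: of_nat_Suc)
  \<comment> \<open>The factor \<open>of_nat k\<close> kills the term k = 0, so the index shift
    leaves the sum unchanged.\<close>
  ultimately have "(\<lambda>k. of_nat k * ?c (Suc m) k * y ^ k) sums (y * bessel_series (Suc (Suc m)) y)"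
    using sums_Suc[of "\<lambda>k. of_nat k * ?c (Suc m) k * y ^ k"] by simp
  then have "(\<lambda>k. of_nat (Suc m) * (?c (Suc m) k * y ^ k) + of_nat k * ?c (Suc m) k * y ^ k) sums
      (of_nat (Suc m) * bessel_series (Suc m) y + y * bessel_series (Suc (Suc m)) y)"
    by (intro sums_add sums_mult s)
  moreover have "of_nat (Suc m) * (?c (Suc m) k * y ^ k) + of_nat k * ?c (Suc m) k * y ^ k = ?c m k * y ^ k" for k
  proof -
    have nz: "(of_nat (Suc (k + m)) :: 'a) \<noteq> 0" by (simp del: of_nat_Suc)
    have "of_nat (Suc m) * (?c (Suc m) k * y ^ k) + of_nat k * ?c (Suc m) k * y ^ k
        = of_nat (Suc (k + m)) * ?c (Suc m) k * y ^ k"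
      by (simp add: algebra_simps add_divide_distrib)
    also have "\<dots> = ?c m k * y ^ k"
      using nz by (simp add: divide_simps del: of_nat_Suc)
    finally show ?thesis .
  qed
  ultimately have "(\<lambda>k. ?c m k * y ^ k) sums
      (of_nat (Suc m) * bessel_series (Suc m) y + y * bessel_series (Suc (Suc m)) y)"
    by simp
  then show ?thesis
    using s sums_unique2 by blast
qed

text \<open>The function J_m for natural m, free of \<open>powr\<close>: entire in u, and also
  available over the reals, where the bounds and integrals live.\<close>

definition bessel_j :: "nat \<Rightarrow> 'a::{real_normed_field,banach} \<Rightarrow> 'a" where
  "bessel_j m u = (u / 2) ^ m * bessel_series m (- (u / 2)\<^sup>2)"

lemma bessel_j_of_real: "bessel_j m (of_real u :: 'a::{real_normed_field,banach}) = of_real (bessel_j m u)"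
  using bessel_series_of_real[of m "- (u / 2)\<^sup>2", where 'a = 'a] by (simp add: bessel_j_def)

lemma bessel_J_1_conv_bessel_j: "bessel_J 1 z = bessel_j 1 z"
proof -
  have "(-1) ^ k * rGamma (1 + of_nat k + 1) / fact k * (z / 2) ^ (2 * k)
      = 1 / (fact k * fact (k + 1)) * (- (z / 2)\<^sup>2) ^ k" for k
  proof -
    have "rGamma (1 + of_nat k + 1 :: complex) = 1 / fact (k + 1)"
      using Gamma_fact[of "Suc k", where 'a = complex] by (simp add: rGamma_inverse_Gamma add_ac divide_inverse del: fact_Suc)
    then show ?thesis
      by (simp only: power_mult power_minus[of "(z / 2)\<^sup>2"]) simp
  qed
  then show ?thesis
    unfolding bessel_J_def bessel_j_def bessel_series_def by (cases "z = 0") simp_all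
qed

lemma has_field_derivative_bessel_j_0:
  "(bessel_j 0 has_field_derivative - bessel_j 1 u) (at u)"
  unfolding bessel_j_def [abs_def]
  by (auto intro!: derivative_eq_intros simp: power2_eq_square)

text \<open>This is J_1' = J_0 - J_1 / u, with J_1(u) / u replaced by its entire form so that u = 0
  is included.\<close>

lemma has_field_derivative_bessel_j_1:
  fixes u :: "'a::{real_normed_field,banach}"
  shows "(bessel_j 1 has_field_derivative bessel_j 0 u - bessel_series 1 (- (u / 2)\<^sup>2) / 2) (at u)"
proof -
  define w where "w = - (u / 2)\<^sup>2"
  have rec: "bessel_series 0 w = bessel_series 1 w - u * u / 4 * bessel_series 2 w"
    using bessel_series_recurrence[of 0 w] by (simp add: w_def power2_eq_square numeral_2_eq_2)
  have der: "(bessel_j 1 has_field_derivative bessel_series 1 w / 2 - u * u / 4 * bessel_series 2 w) (at u)"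
    unfolding bessel_j_def [abs_def]
    by (auto intro!: derivative_eq_intros simp: w_def power2_eq_square numeral_2_eq_2)
  have "a - b / 2 = b / 2 - x" if "a = b - x" for a b x :: 'a
    unfolding that by (simp add: field_simps)
  from this[OF rec] have "bessel_j 0 u - bessel_series 1 w / 2 = bessel_series 1 w / 2 - u * u / 4 * bessel_series 2 w"
    by (simp add: bessel_j_def w_def)
  with der show ?thesis
    by (simp only: w_def)
qed

text \<open>Together with J_0' = - J_1 this is Bessel's equation of order 0 in divergence
  form.\<close>

lemma has_field_derivative_mult_bessel_j_1:
  fixes u :: "'a::{real_normed_field,banach}"
  shows "((\<lambda>u. u * bessel_j 1 u) has_field_derivative u * bessel_j 0 u) (at u)"
  by (rule derivative_eq_intros has_field_derivative_bessel_j_1 refl)+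
     (simp add: bessel_j_def field_simps)

text \<open>The energy J_0^2 + J_1^2 has derivative - 2 J_1^2 / u, hence decreases from its value 1
  at the origin.\<close>

lemma abs_bessel_j_1_le:
  fixes u :: real
  assumes "u \<ge> 0"
  shows "\<bar>bessel_j 1 u\<bar> \<le> 1"
proof -
  let ?f = "\<lambda>u::real. (bessel_j 0 u)\<^sup>2 + (bessel_j 1 u)\<^sup>2"
  have "?f u \<le> ?f 0"
  proof (rule DERIV_nonpos_imp_nonincreasing[OF assms])
    fix x :: real
    assume "0 \<le> x"
    have "(?f has_field_derivative - (x / 2) * (bessel_series 1 (- (x / 2)\<^sup>2))\<^sup>2) (at x)"
      by (rule derivative_eq_intros has_field_derivative_bessel_j_0 has_field_derivative_bessel_j_1 refl)+
         (simp add: bessel_j_def power2_eq_square field_simps)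
    then show "\<exists>y. (?f has_field_derivative y) (at x) \<and> y \<le> 0"
      using \<open>0 \<le> x\<close> by (intro exI[of _ "- (x / 2) * (bessel_series 1 (- (x / 2)\<^sup>2))\<^sup>2"]) simp
  qed
  moreover have "?f 0 = 1"
    by (simp add: bessel_j_def)
  ultimately have "(bessel_j 1 u)\<^sup>2 \<le> 1"
    using zero_le_power2[of "bessel_j 0 u"] by linarith
  then show ?thesis
    by (simp add: abs_square_le_1)
qed

section \<open>Divergence off the real axis\<close>

lemma norm_diff_le_of_vector_derivative_bound:
  fixes f :: "real \<Rightarrow> 'a::real_inner"
  assumes "a \<le> b"
    and der: "\<And>x. a \<le> x \<Longrightarrow> x \<le> b \<Longrightarrow> (f has_vector_derivative f' x) (at x)"
    and bound: "\<And>x. a \<le> x \<Longrightarrow> x \<le> b \<Longrightarrow> norm (f' x) \<le> B"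
  shows "norm (f b - f a) \<le> B * (b - a)"
proof (cases "a = b")
  case False
  have "continuous_on {a..b} f"
    by (auto intro!: continuous_at_imp_continuous_on has_vector_derivative_continuous der)
  then obtain x where x: "a < x" "x < b" "norm (f b - f a) \<le> norm ((b - a) *\<^sub>R f' x)"
    using mvt_general[of a b f "\<lambda>x h. h *\<^sub>R f' x"] der \<open>a \<le> b\<close> False
    by (auto simp: has_vector_derivative_def)
  note x(3)
  also have "norm ((b - a) *\<^sub>R f' x) \<le> B * (b - a)"
    using bound[of x] x \<open>a \<le> b\<close> by (auto simp: mult.commute intro: mult_right_mono)
  finally show ?thesis .
qed simp

text \<open>Gauge integrability over an unbounded set means convergence of the integrals over large
  boxes, so the primitive stays bounded although the integral of the norm may be infinite.\<close>

lemma eventually_bounded_indefinite_integral: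
  fixes f :: "real \<Rightarrow> 'a::banach"
  assumes "f integrable_on {a..}"
  shows "\<exists>M. \<forall>\<^sub>F b in at_top. norm (integral {a..b} f) \<le> M"
proof -
  let ?f = "\<lambda>x. if x \<in> {a..} then f x else 0" and ?I = "integral {a..} f"
  have "(f has_integral ?I) {a..}"
    using assms by (rule integrable_integral)
  then have "\<forall>e>0. \<exists>B>0. \<forall>p q. ball 0 B \<subseteq> cbox p q \<longrightarrow> norm (integral (cbox p q) ?f - ?I) < e"
    unfolding has_integral_alt'[of f] by (rule conjunct2)
  from spec[OF this, of 1] obtain B where
    B: "B > 0" "\<And>p q. ball 0 B \<subseteq> cbox p q \<Longrightarrow> norm (integral (cbox p q) ?f - ?I) < 1"
    by auto
  \<comment> \<open>The left end lies beyond both a and - B: the box then contains the ball and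
    still meets {a..} in {a..b}.\<close>
  define p where "p = min a (- B)"
  have "norm (integral {a..b} f) \<le> norm ?I + 1" if "b \<ge> B" for b
  proof -
    have "ball 0 B \<subseteq> cbox p b"
      using that by (auto simp: dist_real_def p_def)
    then have "norm (integral (cbox p b) ?f - ?I) < 1"
      by (rule B(2))
    moreover have "{a..} \<inter> cbox p b = {a..b}"
      by (auto simp: p_def)
    then have "integral (cbox p b) ?f = integral {a..b} f"
      by (metis integral_restrict_Int)
    ultimately have "norm (integral {a..b} f - ?I) < 1"
      by (simp only:)
    then show ?thesis
      using norm_triangle_ineq2[of "integral {a..b} f" ?I] by linarith
  qed
  then show ?thesis
    by (auto simp: eventually_at_top_linorder)
qed

section \<open>Growth of Bessel functions along a complex ray\<close>

context
  fixes z :: complex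
begin

definition ray_j where "ray_j m c = bessel_j m (of_real c * z)"

lemma has_vector_derivative_ray_j_0:
  "(ray_j 0 has_vector_derivative - z * ray_j 1 c) (at c within S)"
proof -
  have "((\<lambda>w. bessel_j 0 (w * z)) has_field_derivative - bessel_j 1 (of_real c * z) * (1 * z)) (at (of_real c))"
    by (rule DERIV_chain2[OF has_field_derivative_bessel_j_0 DERIV_cmult_right[OF DERIV_ident]])
  from has_vector_derivative_real_field[OF this, of S] show ?thesis
    by (simp add: ray_j_def[abs_def] mult.commute)
qed

lemma has_vector_derivative_mult_ray_j_1:
  "((\<lambda>c. of_real c * ray_j 1 c) has_vector_derivative of_real c * z * ray_j 0 c) (at c within S)"
proof (cases "z = 0")
  case False
  have "((\<lambda>w. (w * z) * bessel_j 1 (w * z) / z) has_field_derivative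
      (of_real c * z * bessel_j 0 (of_real c * z)) * (1 * z) / z) (at (of_real c))"
    by (rule DERIV_cdivide[OF DERIV_chain2[OF has_field_derivative_mult_bessel_j_1
      DERIV_cmult_right[OF DERIV_ident]]])
  from has_vector_derivative_real_field[OF this, of S] show ?thesis
    using False by (simp add: ray_j_def[abs_def])
next
  case True
  show ?thesis
    unfolding ray_j_def[abs_def] bessel_j_def using True by simp
qed

lemma continuous_on_ray_j: "continuous_on A (ray_j m)"
  unfolding ray_j_def[abs_def] bessel_j_def by (intro continuous_intros) auto

lemma bessel_integrand_conv_ray_j: "bessel_integrand z c = of_real (c\<^sup>2 / (1 + c\<^sup>2)\<^sup>2) * ray_j 1 c"
  by (simp add: bessel_integrand_def ray_j_def bessel_J_1_conv_bessel_j del: One_nat_def)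

text \<open>J_1 enters without the factor z of the c-derivative of J_0(cz). The true Wronskian of
  J_0(cz) and its conjugate has a derivative proportional to Im (z^2), which vanishes on the
  imaginary axis; in this variant |J_0|^2 and |J_1|^2 both appear with the coefficient c Im z,
  because Im (- cnj z) = Im z.\<close>

definition ray_wronskian where
  "ray_wronskian c = Im (of_real c * ray_j 1 c * cnj (ray_j 0 c))"

lemma has_field_derivative_ray_wronskian:
  "(ray_wronskian has_field_derivative
    Im z * (c * ((cmod (ray_j 0 c))\<^sup>2 + (cmod (ray_j 1 c))\<^sup>2))) (at c within S)"
proof -
  have "((\<lambda>c. (of_real c * ray_j 1 c) * cnj (ray_j 0 c)) has_vector_derivative
      (of_real c * ray_j 1 c) * cnj (- z * ray_j 1 c) + (of_real c * z * ray_j 0 c) * cnj (ray_j 0 c))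
      (at c within S)"
    by (intro has_vector_derivative_mult has_vector_derivative_cnj
      has_vector_derivative_mult_ray_j_1 has_vector_derivative_ray_j_0)
  then have "(ray_wronskian has_vector_derivative
      Im ((of_real c * ray_j 1 c) * cnj (- z * ray_j 1 c) + (of_real c * z * ray_j 0 c) * cnj (ray_j 0 c)))
      (at c within S)"
    unfolding ray_wronskian_def[abs_def]
    by (rule bounded_linear.has_vector_derivative[OF bounded_linear_Im])
  also have "(of_real c * ray_j 1 c) * cnj (- z * ray_j 1 c) + (of_real c * z * ray_j 0 c) * cnj (ray_j 0 c)
     = of_real c * (z * of_real ((cmod (ray_j 0 c))\<^sup>2) - cnj z * of_real ((cmod (ray_j 1 c))\<^sup>2))"
    by (simp only: complex_norm_square complex_cnj_mult complex_cnj_minus) (simp add: algebra_simps)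
  finally show ?thesis
    by (simp add: has_real_derivative_iff_has_vector_derivative algebra_simps)
qed

text \<open>A Gronwall argument. After normalising the sign, k' = |Im z| e, and 2ab <= a^2 + b^2
  gives 2k <= e, so k' >= 2 |Im z| k and k times exp (- 2 |Im z| c) is nondecreasing on c >=
  0.\<close>

lemma ray_wronskian_exponential_growth:
  assumes "Im z \<noteq> 0"
  shows "\<exists>\<delta> > 0. \<exists>b. \<forall>c \<ge> b. \<delta> * exp (2 * \<bar>Im z\<bar> * c) \<le> \<bar>ray_wronskian c\<bar>"
proof -
  define k where "k = (\<lambda>c. sgn (Im z) * ray_wronskian c)"
  define e where "e = (\<lambda>c. c * ((cmod (ray_j 0 c))\<^sup>2 + (cmod (ray_j 1 c))\<^sup>2))"
  have dk: "(k has_field_derivative \<bar>Im z\<bar> * e c) (at c)" for c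
    unfolding k_def e_def
    by (rule derivative_eq_intros has_field_derivative_ray_wronskian refl)+ (simp add: sgn_if)
  have ke: "2 * k c \<le> e c" if "c \<ge> 0" for c
  proof -
    have "k c \<le> cmod (of_real c * ray_j 1 c * cnj (ray_j 0 c))"
      using abs_Im_le_cmod[of "of_real c * ray_j 1 c * cnj (ray_j 0 c)"]
      by (auto simp: k_def ray_wronskian_def sgn_if)
    also have "2 * \<dots> = c * (2 * cmod (ray_j 0 c) * cmod (ray_j 1 c))"
      using that by (simp add: norm_mult)
    also have "\<dots> \<le> e c"
      unfolding e_def using that by (intro mult_left_mono sum_squares_bound)
    finally show ?thesis by simp
  qed
  define q where "q = (\<lambda>c. k c * exp (- 2 * \<bar>Im z\<bar> * c))"
  have q_mono: "q a \<le> q b" if "0 \<le> a" "a \<le> b" for a b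
  proof (rule DERIV_nonneg_imp_nondecreasing[OF that(2)])
    fix c assume "a \<le> c"
    have "(q has_field_derivative \<bar>Im z\<bar> * (e c - 2 * k c) * exp (- 2 * \<bar>Im z\<bar> * c)) (at c)"
      unfolding q_def by (rule derivative_eq_intros dk refl)+ (simp add: algebra_simps)
    moreover have "\<bar>Im z\<bar> * (e c - 2 * k c) * exp (- 2 * \<bar>Im z\<bar> * c) \<ge> 0"
      using ke[of c] \<open>a \<le> c\<close> \<open>0 \<le> a\<close> by simp
    ultimately show "\<exists>y. (q has_field_derivative y) (at c) \<and> y \<ge> 0"
      by blast
  qed
  \<comment> \<open>As k vanishes at 0, a strictly positive value must come from e > 0 just to the
    right of 0, where J_0(cz) is still nonzero.\<close>
  have "isCont (ray_j 0) 0"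
    using continuous_on_ray_j[of UNIV] by (simp add: continuous_on_eq_continuous_at)
  moreover have "ray_j 0 0 \<noteq> 0"
    by (simp add: ray_j_def bessel_j_def)
  ultimately obtain \<epsilon> where \<epsilon>: "\<epsilon> > 0" "\<And>c. \<bar>c\<bar> < \<epsilon> \<Longrightarrow> ray_j 0 c \<noteq> 0"
    using continuous_at_avoid[of 0 "ray_j 0" 0] by (auto simp: dist_real_def)
  obtain \<xi> where \<xi>: "0 < \<xi>" "\<xi> < \<epsilon>" "k \<epsilon> - k 0 = (\<epsilon> - 0) * (\<bar>Im z\<bar> * e \<xi>)"
    using MVT2[of 0 \<epsilon> k "\<lambda>c. \<bar>Im z\<bar> * e c"] \<epsilon>(1) dk by blast
  have "e \<xi> > 0"
    unfolding e_def using \<epsilon>(2)[of \<xi>] \<xi> by (intro mult_pos_pos add_pos_nonneg) auto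
  then have "k \<epsilon> > 0"
    using \<xi> \<epsilon>(1) assms by (simp add: k_def ray_wronskian_def)
  then have "q \<epsilon> > 0"
    by (simp add: q_def)
  moreover have "q \<epsilon> * exp (2 * \<bar>Im z\<bar> * c) \<le> \<bar>ray_wronskian c\<bar>" if "c \<ge> \<epsilon>" for c
  proof -
    have "q \<epsilon> * exp (2 * \<bar>Im z\<bar> * c) \<le> q c * exp (2 * \<bar>Im z\<bar> * c)"
      using q_mono[of \<epsilon> c] that \<epsilon>(1) by simp
    also have "\<dots> = k c"
      by (simp add: q_def exp_minus field_simps)
    also have "\<dots> \<le> \<bar>ray_wronskian c\<bar>"
      by (auto simp: k_def sgn_if)
    finally show ?thesis .
  qed
  ultimately show ?thesis by blast
qed

text \<open>A bounded primitive G of the integrand gives J_0(cz) = O(c^2); integrating (c J_1(cz))'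
  = c z J_0(cz) then gives c J_1(cz) = O(c^4), and the product is O(c^6).\<close>

lemma ray_wronskian_polynomial_growth:
  assumes "bessel_integrand z integrable_on {0..}"
  shows "\<exists>K b. \<forall>c \<ge> b. \<bar>ray_wronskian c\<bar> \<le> K * c ^ 6"
proof -
  let ?f = "bessel_integrand z"
  have pos: "1 + c\<^sup>2 \<noteq> 0" for c :: real
    by (simp add: add_nonneg_eq_0_iff)
  have contf: "continuous_on A ?f" for A
    unfolding bessel_integrand_conv_ray_j[abs_def]
    by (intro continuous_intros continuous_on_ray_j) (auto simp: pos)
  define G where "G = (\<lambda>c. integral {0..c} ?f)"
  obtain M b0 where M: "\<And>c. c \<ge> b0 \<Longrightarrow> cmod (G c) \<le> M"
    using eventually_bounded_indefinite_integral[OF assms]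
    unfolding G_def eventually_at_top_linorder by blast
  \<comment> \<open>Starting at 1 or later lets constants and 1 / c^2 be absorbed into powers of
    c.\<close>
  define b where "b = max 1 b0"
  have b: "b \<ge> 1" "\<And>c. c \<ge> b \<Longrightarrow> cmod (G c) \<le> M"
    using M by (auto simp: b_def)
  have "M \<ge> 0"
    using b(2)[of b] norm_ge_zero order_trans by blast
  have dG: "(G has_vector_derivative ?f c) (at c)" if "c > 0" for c
  proof -
    have "(G has_vector_derivative ?f c) (at c within {0..c+1})"
      unfolding G_def using that by (intro integral_has_vector_derivative contf) auto
    then show ?thesis
      using that by (simp add: at_within_Icc_at)
  qed
  \<comment> \<open>\<open>p\<close> is the reciprocal of the weight \<open>c\<^sup>2 / (1 + c\<^sup>2)\<^sup>2\<close>, so that \<open>J\<^sub>0(cz)\<close> has derivative \<open>- z p G'\<close>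
    and integration by parts bounds it in terms of the bounded function \<open>G\<close>.\<close>
  define p where "p = (\<lambda>c::real. c\<^sup>2 + 2 + 1 / c\<^sup>2)"
  have dp: "((\<lambda>c. complex_of_real (p c)) has_vector_derivative of_real (2 * c - 2 / c ^ 3)) (at c)" if "c > 0" for c
  proof -
    have "(p has_field_derivative 2 * c - 2 / c ^ 3) (at c)"
      unfolding p_def using that
      by (auto intro!: derivative_eq_intros simp: field_simps power2_eq_square power3_eq_cube)
    then show ?thesis
      by (intro has_vector_derivative_of_real) (simp add: has_real_derivative_iff_has_vector_derivative)
  qed
  \<comment> \<open>Adding the boundary term of the integration by parts to J_0(cz) leaves the
    derivative z p' G, which involves only the bounded G and not the integrand.\<close>
  define V where "V = (\<lambda>c. ray_j 0 c + z * (of_real (p c) * G c))"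
  have dV: "(V has_vector_derivative z * (of_real (2 * c - 2 / c ^ 3) * G c)) (at c)" if "c > 0" for c
  proof -
    have "p c * (c\<^sup>2 / (1 + c\<^sup>2)\<^sup>2) = 1"
      using that pos[of c] by (simp add: p_def field_simps) (simp add: eval_nat_numeral algebra_simps)
    then have "of_real (p c) * ?f c = ray_j 1 c"
      by (simp only: bessel_integrand_conv_ray_j mult.assoc[symmetric] of_real_mult[symmetric]) simp
    moreover have "(V has_vector_derivative
        - z * ray_j 1 c + z * (of_real (p c) * ?f c + of_real (2 * c - 2 / c ^ 3) * G c)) (at c)"
      unfolding V_def using that
      by (intro has_vector_derivative_add has_vector_derivative_mult has_vector_derivative_mult_right
        has_vector_derivative_ray_j_0 dG dp)
    ultimately show ?thesis
      by (simp add: algebra_simps)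
  qed
  \<comment> \<open>The 6 is 2 + 4: the first from integrating |p'| <= 2c up to c, the second from p
    <= 4 c^2 in the boundary term.\<close>
  define K where "K = cmod (V b) + 6 * cmod z * M"
  have "K \<ge> 0"
    using \<open>M \<ge> 0\<close> by (simp add: K_def)
  have u0: "cmod (ray_j 0 c) \<le> K * c\<^sup>2" if "c \<ge> b" for c
  proof -
    have "cmod (V c - V b) \<le> (cmod z * (2 * c * M)) * (c - b)"
    proof (rule norm_diff_le_of_vector_derivative_bound[OF that dV])
      fix x assume x: "b \<le> x" "x \<le> c"
      then have "2 / x ^ 3 \<le> 2"
        using b(1) by (simp add: divide_simps one_le_power)
      then have "\<bar>2 * x - 2 / x ^ 3\<bar> \<le> 2 * c"
        using x b(1) by (smt (verit) divide_nonneg_nonneg zero_le_power)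
      then show "cmod (z * (of_real (2 * x - 2 / x ^ 3) * G x)) \<le> cmod z * (2 * c * M)"
        using b x unfolding norm_mult norm_of_real by (intro mult_left_mono mult_mono) auto
    qed (use b in auto)
    also have "\<dots> \<le> (cmod z * (2 * c * M)) * c"
      using b that \<open>M \<ge> 0\<close> by (intro mult_left_mono) auto
    finally have "cmod (V c) \<le> cmod (V b) + 2 * cmod z * M * c\<^sup>2"
      using norm_triangle_ineq2[of "V c" "V b"] by (simp add: power2_eq_square algebra_simps)
    moreover have "cmod (V b) \<le> cmod (V b) * c\<^sup>2"
      using b that by (simp add: mult_le_cancel_left1 one_le_power)
    moreover have "cmod (z * (of_real (p c) * G c)) \<le> cmod z * (4 * c\<^sup>2 * M)"
    proof -
      have "c\<^sup>2 \<ge> 1" using b that by (simp add: one_le_power)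
      moreover from this have "1 / c\<^sup>2 \<le> 1"
        using le_imp_inverse_le[of 1 "c\<^sup>2"] by (simp add: inverse_eq_divide)
      moreover have "1 / c\<^sup>2 \<ge> 0" by simp
      ultimately have "\<bar>p c\<bar> \<le> 4 * c\<^sup>2"
        unfolding p_def by linarith
      then show ?thesis
        unfolding norm_mult norm_of_real using b that by (intro mult_left_mono mult_mono) auto
    qed
    moreover have "cmod (ray_j 0 c) \<le> cmod (V c) + cmod (z * (of_real (p c) * G c))"
      using norm_triangle_ineq4[of "V c" "z * (of_real (p c) * G c)"] by (simp add: V_def)
    ultimately show ?thesis
      by (simp add: K_def algebra_simps)
  qed
  define L where "L = cmod (of_real b * ray_j 1 b) + cmod z * K"
  have u1: "cmod (of_real c * ray_j 1 c) \<le> L * c ^ 4" if "c \<ge> b" for c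
  proof -
    have "cmod (of_real c * ray_j 1 c - of_real b * ray_j 1 b) \<le> (c * cmod z * (K * c\<^sup>2)) * (c - b)"
    proof (rule norm_diff_le_of_vector_derivative_bound[OF that has_vector_derivative_mult_ray_j_1])
      fix x assume x: "b \<le> x" "x \<le> c"
      then have "cmod (ray_j 0 x) \<le> K * c\<^sup>2"
        using u0[of x] b \<open>K \<ge> 0\<close> by (meson mult_left_mono order_trans power_mono zero_le_one)
      then show "cmod (of_real x * z * ray_j 0 x) \<le> c * cmod z * (K * c\<^sup>2)"
        unfolding norm_mult norm_of_real using x b by (intro mult_mono) auto
    qed
    also have "\<dots> \<le> (c * cmod z * (K * c\<^sup>2)) * c"
      using b that \<open>K \<ge> 0\<close> by (intro mult_left_mono) auto
    finally have "cmod (of_real c * ray_j 1 c) \<le> cmod (of_real b * ray_j 1 b) + cmod z * K * c ^ 4"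
      using norm_triangle_ineq2[of "of_real c * ray_j 1 c" "of_real b * ray_j 1 b"]
      by (simp add: power4_eq_xxxx power2_eq_square algebra_simps)
    moreover have "cmod (of_real b * ray_j 1 b) \<le> cmod (of_real b * ray_j 1 b) * c ^ 4"
      using b that by (subst mult_le_cancel_left1) (auto simp: one_le_power)
    ultimately show ?thesis
      by (simp add: L_def algebra_simps)
  qed
  have "\<bar>ray_wronskian c\<bar> \<le> (L * K) * c ^ 6" if "c \<ge> b" for c
  proof -
    have "\<bar>ray_wronskian c\<bar> \<le> cmod (of_real c * ray_j 1 c * cnj (ray_j 0 c))"
      unfolding ray_wronskian_def by (rule abs_Im_le_cmod)
    also have "\<dots> = cmod (of_real c * ray_j 1 c) * cmod (ray_j 0 c)"
      by (simp add: norm_mult)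
    also have "\<dots> \<le> (L * c ^ 4) * (K * c\<^sup>2)"
      using u0[OF that] u1[OF that] order_trans[OF norm_ge_zero u1[OF that]]
      by (intro mult_mono) auto
    finally show ?thesis by (simp add: power_add[symmetric] algebra_simps)
  qed
  then show ?thesis by blast
qed

lemma not_integrable_bessel_integrand:
  assumes "Im z \<noteq> 0"
  shows "\<not> bessel_integrand z integrable_on {0..}"
proof
  assume "bessel_integrand z integrable_on {0..}"
  then obtain K b where K: "\<And>c. c \<ge> b \<Longrightarrow> \<bar>ray_wronskian c\<bar> \<le> K * c ^ 6"
    using ray_wronskian_polynomial_growth by blast
  obtain \<delta> b' where \<delta>: "\<delta> > 0" "\<And>c. c \<ge> b' \<Longrightarrow> \<delta> * exp (2 * \<bar>Im z\<bar> * c) \<le> \<bar>ray_wronskian c\<bar>"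
    using ray_wronskian_exponential_growth[OF assms] by blast
  define y where "y = \<bar>Im z\<bar>"
  have "y > 0" using assms by (simp add: y_def)
  then have "((\<lambda>c. K * c ^ 6 * exp (- 2 * y * c)) \<longlongrightarrow> 0) at_top"
    by real_asymp
  then have "\<forall>\<^sub>F c in at_top. K * c ^ 6 * exp (- 2 * y * c) < \<delta>"
    using \<delta>(1) by (rule order_tendstoD)
  then have "\<forall>\<^sub>F c in at_top. K * c ^ 6 * exp (- 2 * y * c) < \<delta> \<and> b \<le> c \<and> b' \<le> c"
    by (intro eventually_conj eventually_ge_at_top)
  then obtain c where c: "K * c ^ 6 * exp (- 2 * y * c) < \<delta>" "b \<le> c" "b' \<le> c"
    by (auto dest: eventually_happens)
  have "\<delta> * exp (2 * y * c) \<le> K * c ^ 6"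
      using K[OF c(2)] \<delta>(2)[OF c(3)] by (simp add: y_def)
    then have "\<delta> * exp (2 * y * c) * exp (- 2 * y * c) \<le> K * c ^ 6 * exp (- 2 * y * c)"
      by (rule mult_right_mono) simp
    then show False
      using c(1) by (simp add: mult.assoc mult_exp_exp)
qed

end

section \<open>The logarithmic series of \<open>K\<^sub>0\<close>\<close>

text \<open>The numerator \<open>harm k - euler_mascheroni\<close> is the digamma function at k + 1,
  as it arises from differentiating 1 / Gamma in the order.\<close>

definition digamma_series :: "'a::{real_normed_field,banach} \<Rightarrow> 'a" where
  "digamma_series y = (\<Sum>k. of_real ((harm k - euler_mascheroni) / (fact k)\<^sup>2) * y ^ k)"

text \<open>By 1 / Gamma(w) = w / Gamma(w + 1) with |w| >= 1/2, each shift costs a factor of at most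
  2. The bound is uniform in the order near 0 and is beaten by the factorial in the series.\<close>

lemma norm_rGamma_shift_le:
  fixes \<mu> :: complex
  assumes "norm \<mu> \<le> 1 / 2"
  shows "norm (rGamma (\<mu> + of_nat k + 1)) \<le> norm (rGamma (\<mu> + 1)) * 2 ^ k"
proof (induction k)
  case (Suc k)
  let ?w = "\<mu> + of_nat k + 1"
  have "1 / 2 \<le> Re ?w"
    using abs_Re_le_cmod[of \<mu>] assms by simp
  also have "\<dots> \<le> norm ?w" by (rule complex_Re_le_cmod)
  finally have "norm (rGamma (?w + 1)) \<le> norm (rGamma (?w + 1)) * (2 * norm ?w)"
    by (simp add: mult_le_cancel_left1)
  also have "\<dots> = 2 * norm (?w * rGamma (?w + 1))"
    by (simp add: norm_mult)
  also have "\<dots> \<le> 2 * (norm (rGamma (\<mu> + 1)) * 2 ^ k)"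
    unfolding rGamma_plus1 using Suc.IH by simp
  finally show ?case by (simp add: add_ac)
qed simp

lemma Re_pos_not_nonpos_Ints: "Re w > 0 \<Longrightarrow> w \<notin> \<int>\<^sub>\<le>\<^sub>0"
  by (auto elim!: nonpos_Ints_cases)

text \<open>The series is differentiated termwise in the order. The terms are holomorphic in mu, so
  a summable majorant of the terms themselves suffices and the Digamma factors need no estimate.
  Convergence of the digamma series comes out at the same time.\<close>

lemma bessel_I_order_derivative:
  fixes z :: complex
  assumes "z \<noteq> 0"
  defines "y \<equiv> (z / 2)\<^sup>2"
  shows "((\<lambda>\<mu>. bessel_I \<mu> z) has_field_derivative Ln (z / 2) * bessel_series 0 y - digamma_series y) (at 0)"
    and "summable (\<lambda>k. of_real ((harm k - euler_mascheroni) / (fact k)\<^sup>2) * y ^ k)"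
proof -
  define f where "f = (\<lambda>k \<mu>. rGamma (\<mu> + of_nat k + 1) / fact k * y ^ k)"
  define f' where "f' = (\<lambda>k \<mu>. - rGamma (\<mu> + of_nat k + 1) * Digamma (\<mu> + of_nat k + 1) / fact k * y ^ k)"
  let ?S = "ball (0::complex) (1/2)"
  have "compact ((\<lambda>\<mu>::complex. rGamma (\<mu> + 1)) ` cball 0 (1/2))"
    by (intro compact_continuous_image holomorphic_on_imp_continuous_on holomorphic_intros) auto
  then obtain C where C: "\<And>\<mu>::complex. norm \<mu> \<le> 1/2 \<Longrightarrow> norm (rGamma (\<mu> + 1)) \<le> C"
    by (force dest!: compact_imp_bounded simp: bounded_iff)
  have "C \<ge> 0"
    using C[of 0] norm_ge_zero order_trans by (metis norm_zero zero_le_divide_1_iff zero_le_numeral)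
  define h where "h = (\<lambda>k. C * (inverse (fact k) * (2 * norm y) ^ k))"
  have h: "summable h" "\<And>k. h k \<ge> 0"
    unfolding h_def using \<open>C \<ge> 0\<close> by (intro summable_mult summable_exp, simp)
  have fh: "norm (f k \<mu>) \<le> h k" if "norm \<mu> \<le> 1/2" for k \<mu>
  proof -
    have "norm (rGamma (\<mu> + of_nat k + 1)) \<le> C * 2 ^ k"
      using norm_rGamma_shift_le[OF that, of k] C[OF that]
      by (meson mult_right_mono order_trans zero_le_numeral zero_le_power)
    then have "norm (f k \<mu>) \<le> C * 2 ^ k / fact k * norm y ^ k"
      unfolding f_def norm_mult norm_divide norm_power norm_fact
      by (intro mult_right_mono divide_right_mono) auto
    then show ?thesis
      by (simp add: h_def power_mult_distrib field_simps)
  qed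
  have "\<exists>g g'. \<forall>\<mu> \<in> ?S. (\<lambda>k. f k \<mu>) sums g \<mu> \<and> (\<lambda>k. f' k \<mu>) sums g' \<mu> \<and>
      (g has_field_derivative g' \<mu>) (at \<mu>)"
  proof (rule series_and_derivative_comparison_complex)
    fix k \<mu> assume "\<mu> \<in> ?S"
    then have "Re (\<mu> + of_nat k + 1) > 0"
      using abs_Re_le_cmod[of \<mu>] by simp
    then have "\<mu> + of_nat k + 1 \<notin> \<int>\<^sub>\<le>\<^sub>0"
      by (rule Re_pos_not_nonpos_Ints)
    then show "(f k has_field_derivative f' k \<mu>) (at \<mu>)"
      unfolding f_def f'_def by (auto intro!: derivative_eq_intros)
  next
    fix \<mu> :: complex
    show "\<exists>d h. 0 < d \<and> summable (h :: nat \<Rightarrow> complex) \<and> range h \<subseteq> \<real>\<^sub>\<ge>\<^sub>0 \<and>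
        (\<forall>\<^sub>F n in sequentially. \<forall>y\<in>ball \<mu> d \<inter> ?S. norm (f n y) \<le> norm (h n))"
      by (rule exI[of _ 1], rule exI[of _ "\<lambda>k. complex_of_real (h k)"])
         (use h fh in \<open>auto simp: summable_of_real abs_of_nonneg intro!: always_eventually\<close>)
  qed auto
  then obtain g g' where g: "\<And>\<mu>. \<mu> \<in> ?S \<Longrightarrow> (\<lambda>k. f k \<mu>) sums g \<mu>"
    "\<And>\<mu>. \<mu> \<in> ?S \<Longrightarrow> (\<lambda>k. f' k \<mu>) sums g' \<mu>"
    "\<And>\<mu>. \<mu> \<in> ?S \<Longrightarrow> (g has_field_derivative g' \<mu>) (at \<mu>)"
    by blast
  have rG: "rGamma (of_nat k + 1 :: complex) = 1 / fact k" for k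
    using Gamma_fact[of k, where 'a = complex] by (simp add: rGamma_inverse_Gamma add_ac divide_inverse)
  have "Digamma (of_nat k + 1 :: complex) = of_real (harm k - euler_mascheroni)" for k
    using Digamma_of_nat[of k, where 'a = complex] by (simp add: add.commute of_real_harm)
  then have "f' k 0 = - (of_real ((harm k - euler_mascheroni) / (fact k)\<^sup>2) * y ^ k)" for k
    by (simp add: f'_def rG power2_eq_square)
  then have *: "(\<lambda>k. of_real ((harm k - euler_mascheroni) / (fact k)\<^sup>2) * y ^ k) sums - g' 0"
    using sums_minus[OF g(2)[of 0]] by simp
  then show "summable (\<lambda>k. of_real ((harm k - euler_mascheroni) / (fact k)\<^sup>2) * y ^ k)"
    by (rule sums_summable)
  have g'0: "g' 0 = - digamma_series y"
    using sums_unique[OF *] unfolding digamma_series_def by (metis minus_minus)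
  have "f k 0 = 1 / (fact k * fact (k + 0)) * y ^ k" for k
    by (simp add: f_def rG)
  then have g0: "g 0 = bessel_series 0 y"
    using sums_unique[OF g(1)[of 0]] by (simp add: bessel_series_def)
  have dg: "(g has_field_derivative - digamma_series y) (at 0)"
    using g(3)[of 0] by (simp add: g'0)
  have "((\<lambda>\<mu>. (z / 2) powr \<mu>) has_field_derivative Ln (z / 2)) (at 0)"
    using assms(1) by (auto intro!: derivative_eq_intros)
  from DERIV_mult[OF this dg] have "((\<lambda>\<mu>. (z / 2) powr \<mu> * g \<mu>) has_field_derivative
      Ln (z / 2) * bessel_series 0 y - digamma_series y) (at 0)"
    using assms(1) by (simp add: g0)
  then show "((\<lambda>\<mu>. bessel_I \<mu> z) has_field_derivative
      Ln (z / 2) * bessel_series 0 y - digamma_series y) (at 0)"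
  proof (rule DERIV_cong_ev[THEN iffD1, rotated 3])
    have "\<forall>\<^sub>F \<mu> in nhds 0. \<mu> \<in> ?S"
      by (intro eventually_nhds_in_open) auto
    then show "\<forall>\<^sub>F \<mu> in nhds 0. (z / 2) powr \<mu> * g \<mu> = bessel_I \<mu> z"
    proof eventually_elim
      case (elim \<mu>)
      show ?case
        using sums_unique[OF g(1)[OF elim]]
        by (simp add: bessel_I_def f_def y_def power_mult)
    qed
  qed auto
qed

text \<open>L'Hospital by hand: numerator and denominator of the quotient are divided by mu and tend
  to the derivatives - 2d and pi, so the limit is - d.\<close>

lemma bessel_K_0_conv_series:
  assumes "z \<noteq> 0"
  shows "bessel_K 0 z = digamma_series ((z / 2)\<^sup>2) - Ln (z / 2) * bessel_series 0 ((z / 2)\<^sup>2)"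
proof -
  define d where "d = Ln (z / 2) * bessel_series 0 ((z / 2)\<^sup>2) - digamma_series ((z / 2)\<^sup>2)"
  note dI = bessel_I_order_derivative(1)[OF assms, folded d_def]
  have "((\<lambda>\<mu>. bessel_I (- \<mu>) z) has_field_derivative d * (- 1)) (at 0)"
    by (rule DERIV_chain2[of "\<lambda>\<mu>. bessel_I \<mu> z" d "\<lambda>\<mu>. - \<mu>"])
       (use dI in \<open>auto intro!: derivative_eq_intros\<close>)
  then have dI': "((\<lambda>\<mu>. bessel_I (- \<mu>) z) has_field_derivative - d) (at 0)"
    by simp
  have "((\<lambda>\<mu>. bessel_I (- \<mu>) z - bessel_I \<mu> z) has_field_derivative - d - d) (at 0)"
    by (intro derivative_intros dI dI')
  then have N: "((\<lambda>\<mu>. (bessel_I (- \<mu>) z - bessel_I \<mu> z) / \<mu>) \<longlongrightarrow> - d - d) (at 0)"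
    by (simp add: has_field_derivative_iff)
  have "((\<lambda>\<mu>. sin (of_real pi * \<mu>)) has_field_derivative of_real pi) (at (0::complex))"
    by (auto intro!: derivative_eq_intros)
  then have D: "((\<lambda>\<mu>. sin (of_real pi * \<mu>) / \<mu>) \<longlongrightarrow> of_real pi) (at (0::complex))"
    by (simp add: has_field_derivative_iff)
  have "((\<lambda>\<mu>. of_real pi / 2 * (((bessel_I (- \<mu>) z - bessel_I \<mu> z) / \<mu>) / (sin (of_real pi * \<mu>) / \<mu>)))
      \<longlongrightarrow> of_real pi / 2 * ((- d - d) / of_real pi)) (at 0)"
    by (intro tendsto_intros N D) auto
  also have "?this \<longleftrightarrow> ((\<lambda>\<mu>. bessel_K_quot \<mu> z) \<longlongrightarrow> - d) (at 0)"
  proof (rule filterlim_cong)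
    show "\<forall>\<^sub>F \<mu> in at 0. of_real pi / 2 * (((bessel_I (- \<mu>) z - bessel_I \<mu> z) / \<mu>) /
        (sin (of_real pi * \<mu>) / \<mu>)) = bessel_K_quot \<mu> z"
      using eventually_neq_at_within[of 0]
      by eventually_elim (auto simp: bessel_K_quot_def)
  qed (auto simp: field_simps)
  finally show ?thesis
    by (auto simp: bessel_K_def d_def intro!: tendsto_Lim)
qed

lemma summable_digamma_series:
  fixes y :: "'a::{real_normed_field,banach}"
  shows "summable (\<lambda>k. of_real ((harm k - euler_mascheroni) / (fact k)\<^sup>2) * y ^ k)"
proof (rule summable_norm_cancel)
  let ?c = "\<lambda>k. (harm k - euler_mascheroni) / (fact k)\<^sup>2 :: real"
  \<comment> \<open>A radius strictly beyond \<open>norm y\<close> yields absolute convergence at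
    \<open>norm y\<close>, which carries over to any normed field; the point 2 sqrt r is the one
    with (z / 2)^2 = r.\<close>
  define r where "r = norm y + 1"
  have "r > 0" by (simp add: r_def add_nonneg_pos)
  then have "(of_real (2 * sqrt r) / 2)\<^sup>2 = complex_of_real r"
    by (simp flip: of_real_power)
  then have "summable (\<lambda>k. complex_of_real (?c k) * of_real r ^ k)"
    using bessel_I_order_derivative(2)[of "of_real (2 * sqrt r)"] \<open>r > 0\<close> by simp
  then have "summable (\<lambda>k. norm (complex_of_real (?c k) * of_real (norm y) ^ k))"
    by (rule powser_insidea) (simp add: r_def)
  then show "summable (\<lambda>k. norm (of_real (?c k) * y ^ k))"
    by (simp add: norm_mult norm_power del: of_real_diff of_real_divide)
qed

section \<open>Integration over the positive half-line\<close>

definition half_line :: "real measure" where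
  "half_line = restrict_space lborel {0<..}"

lemma space_half_line [simp]: "space half_line = {0<..}"
  by (simp add: half_line_def space_restrict_space)

lemma measurable_half_line [measurable]: "(\<lambda>x. x) \<in> borel_measurable half_line"
  by (simp add: half_line_def measurable_restrict_space1)

interpretation half_line: sigma_finite_measure half_line
  unfolding half_line_def
  by (rule sigma_finite_measure_restrict_space) (auto intro: lborel.sigma_finite_measure_axioms)

text \<open>Bridge between the Bochner integral, which provides Fubini and dominated convergence,
  and the gauge integral, in which the change of variables and the final theorem are stated.\<close>

lemma has_bochner_integral_half_line_iff:
  fixes f :: "real \<Rightarrow> 'a::euclidean_space"
  assumes [measurable]: "f \<in> borel_measurable borel"
  shows "has_bochner_integral half_line f b \<longleftrightarrow>
    f absolutely_integrable_on {0<..} \<and> integral {0<..} f = b"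
proof -
  have 1: "integrable half_line f \<longleftrightarrow> set_integrable lborel {0<..} f"
    unfolding half_line_def set_integrable_def by (subst integrable_restrict_space) auto
  also have "\<dots> \<longleftrightarrow> f absolutely_integrable_on {0<..}"
    unfolding set_integrable_def by (subst integrable_completion) auto
  finally have 2: "integrable half_line f \<longleftrightarrow> f absolutely_integrable_on {0<..}" .
  have "integral\<^sup>L half_line f = integral {0<..} f" if "integrable half_line f"
    using set_borel_integral_eq_integral(2)[of "{0<..}" f] that 1
    unfolding half_line_def set_lebesgue_integral_def by (subst integral_restrict_space) auto
  with 2 show ?thesis
    by (auto simp: has_bochner_integral_iff)
qed

lemma has_bochner_integral_half_line_substitution:
  fixes f :: "real \<Rightarrow> 'a::euclidean_space"
  assumes [measurable]: "f \<in> borel_measurable borel" "g \<in> borel_measurable borel" "h \<in> borel_measurable borel"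
    and "\<And>x. x > 0 \<Longrightarrow> (g has_field_derivative h x) (at x)"
    and "inj_on g {0<..}" "g ` {0<..} = {0<..}"
  shows "has_bochner_integral half_line (\<lambda>x. \<bar>h x\<bar> *\<^sub>R f (g x)) b \<longleftrightarrow> has_bochner_integral half_line f b"
  using has_absolute_integral_change_of_variables_real[of "{0<..}" g h f b] assms
  by (simp add: has_bochner_integral_half_line_iff has_field_derivative_at_within)

lemma half_line_inversion:
  fixes f :: "real \<Rightarrow> 'a::euclidean_space"
  assumes [measurable]: "f \<in> borel_measurable borel" and "y > 0"
  shows "has_bochner_integral half_line (\<lambda>t. (y / t\<^sup>2) *\<^sub>R f (y / t)) b \<longleftrightarrow> has_bochner_integral half_line f b"
proof -
  have "(\<lambda>t. y / t) ` {0<..} = {0<..}"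
  proof (intro equalityI subsetI)
    fix x :: real assume "x \<in> {0<..}"
    then show "x \<in> (\<lambda>t. y / t) ` {0<..}"
      using \<open>y > 0\<close> by (intro image_eqI[of _ _ "y / x"]) auto
  qed (use \<open>y > 0\<close> in auto)
  then have "has_bochner_integral half_line (\<lambda>t. \<bar>- y / t\<^sup>2\<bar> *\<^sub>R f (y / t)) b \<longleftrightarrow> has_bochner_integral half_line f b"
    using \<open>y > 0\<close>
    by (intro has_bochner_integral_half_line_substitution)
       (auto intro!: derivative_eq_intros inj_onI simp: power2_eq_square)
  then show ?thesis
    using \<open>y > 0\<close> by simp
qed

lemma half_line_FTC:
  fixes f F :: "real \<Rightarrow> real"
  assumes "\<And>t. t > 0 \<Longrightarrow> (F has_field_derivative f t) (at t)" "\<And>t. t > 0 \<Longrightarrow> isCont f t"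
    and "integrable half_line f" "(F \<longlongrightarrow> A) (at_right 0)" "(F \<longlongrightarrow> B) at_top"
  shows "integral\<^sup>L half_line f = B - A"
proof -
  have "set_integrable lborel {0<..} f"
    using assms(3) unfolding half_line_def set_integrable_def by (subst (asm) integrable_restrict_space) auto
  then have "(LBINT t=ereal 0..\<infinity>. f t) = B - A"
    using assms
    by (intro interval_integral_FTC_integrable[where F = F])
       (auto simp: has_real_derivative_iff_has_vector_derivative ereal_tendsto_simps)
  then show ?thesis
    unfolding interval_integral_to_infinity_eq half_line_def set_lebesgue_integral_def
    by (subst integral_restrict_space) auto
qed

lemma has_bochner_integral_Gamma:
  assumes "s > 0" "a > 0"
  shows "has_bochner_integral half_line (\<lambda>t. t powr (s - 1) * exp (- (a * t))) (Gamma s / a powr s)"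
proof -
  let ?f = "\<lambda>t::real. t powr (s - 1) * exp (- t)"
  have "(?f has_integral Gamma s) {0..}"
    using Gamma_integral_real[OF assms(1)] by (simp add: exp_minus divide_inverse)
  then have *: "(?f has_integral Gamma s) {0<..}"
    by (subst has_integral_spike_set_eq[of _ "{0..}"]) (auto intro: negligible_subset[of "{0}"])
  then have "?f absolutely_integrable_on {0<..}"
    by (intro nonnegative_absolutely_integrable_1) auto
  with * have "has_bochner_integral half_line ?f (Gamma s)"
    by (subst has_bochner_integral_half_line_iff) (auto simp: integral_unique)
  also have "?this \<longleftrightarrow> has_bochner_integral half_line (\<lambda>t. \<bar>a\<bar> *\<^sub>R ?f (a * t)) (Gamma s)"
  proof (rule has_bochner_integral_half_line_substitution[symmetric])
    show "(\<lambda>t. a * t) ` {0<..} = {0<..}"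
    proof (intro equalityI subsetI)
      fix x :: real assume "x \<in> {0<..}"
      then show "x \<in> (\<lambda>t. a * t) ` {0<..}"
        using assms by (intro image_eqI[of _ _ "x / a"]) auto
    qed (use assms in auto)
  qed (use assms in \<open>auto intro!: derivative_eq_intros inj_onI\<close>)
  finally have "has_bochner_integral half_line (\<lambda>t. (\<bar>a\<bar> *\<^sub>R ?f (a * t)) / a powr s) (Gamma s / a powr s)"
    by (intro has_bochner_integral_divide) 
  also have "?this \<longleftrightarrow> ?thesis"
  proof (rule has_bochner_integral_cong)
    fix t assume "t \<in> space half_line"
    then have "(a * t) powr (s - 1) = a powr s / a * t powr (s - 1)"
      using assms by (simp add: powr_mult powr_diff)
    then show "(\<bar>a\<bar> *\<^sub>R ?f (a * t)) / a powr s = t powr (s - 1) * exp (- (a * t))"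
      using assms by simp
  qed auto
  finally show ?thesis .
qed

lemma has_bochner_integral_exp: "has_bochner_integral half_line (\<lambda>t. exp (- t)) 1"
proof -
  have "has_bochner_integral half_line (\<lambda>t. t powr (1 - 1) * exp (- (1 * t))) (Gamma 1 / 1 powr 1)"
    by (rule has_bochner_integral_Gamma) auto
  also have "?this \<longleftrightarrow> ?thesis"
    by (rule has_bochner_integral_cong) auto
  finally show ?thesis .
qed

text \<open>Dominated convergence along sequences: the mean value inequality bounds the difference
  quotients by g, and measurability of the derivative follows because it is their limit.\<close>

lemma has_field_derivative_integral:
  fixes f :: "real \<Rightarrow> 'a \<Rightarrow> real"
  assumes x: "x \<in> {a<..<b}"
    and int: "\<And>x. x \<in> {a<..<b} \<Longrightarrow> integrable M (f x)"
    and der: "\<And>x t. x \<in> {a<..<b} \<Longrightarrow> t \<in> space M \<Longrightarrow> ((\<lambda>x. f x t) has_field_derivative f' x t) (at x)"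
    and bound: "\<And>x t. x \<in> {a<..<b} \<Longrightarrow> t \<in> space M \<Longrightarrow> \<bar>f' x t\<bar> \<le> g t"
    and "integrable M g"
  shows "((\<lambda>x. \<integral>t. f x t \<partial>M) has_field_derivative (\<integral>t. f' x t \<partial>M)) (at x)"
proof -
  have "((\<lambda>u. ((\<integral>t. f u t \<partial>M) - (\<integral>t. f x t \<partial>M)) / (u - x)) \<longlongrightarrow> (\<integral>t. f' x t \<partial>M)) (at x within {a<..<b})"
    unfolding tendsto_at_iff_sequentially
  proof (intro allI impI)
    fix X assume X: "\<forall>i. X i \<in> {a<..<b} - {x}" "X \<longlonglongrightarrow> x"
    define q where "q = (\<lambda>i t. (f (X i) t - f x t) / (X i - x))"
    have q_int: "integrable M (q i)" for i
      unfolding q_def using X(1) x by (intro integrable_divide Bochner_Integration.integrable_diff int) auto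
    have q_lim: "(\<lambda>i. q i t) \<longlonglongrightarrow> f' x t" if "t \<in> space M" for t
    proof -
      have "((\<lambda>u. (f u t - f x t) / (u - x)) \<longlongrightarrow> f' x t) (at x)"
        using der[OF x that] by (simp add: has_field_derivative_iff)
      then show ?thesis
        using X by (auto simp: tendsto_at_iff_sequentially q_def comp_def)
    qed
    have q_le: "\<bar>q i t\<bar> \<le> g t" if "t \<in> space M" for i t
    proof -
      have "norm (f (X i) t - f x t) \<le> g t * norm (X i - x)"
        by (rule field_differentiable_bound[of "{a<..<b}" "\<lambda>x. f x t" "\<lambda>x. f' x t"])
           (use X(1) x that der bound in \<open>auto intro: has_field_derivative_at_within\<close>)
      moreover have "\<bar>X i - x\<bar> > 0"
        using X(1) by simp
      ultimately show ?thesis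
        by (simp add: q_def pos_divide_le_eq)
    qed
    have "(\<lambda>i. integral\<^sup>L M (q i)) \<longlonglongrightarrow> integral\<^sup>L M (f' x)"
    proof (rule integral_dominated_convergence[OF _ _ \<open>integrable M g\<close>])
      show q_meas: "q i \<in> borel_measurable M" for i
        by (rule borel_measurable_integrable[OF q_int])
      show "f' x \<in> borel_measurable M"
        by (rule borel_measurable_LIMSEQ_real[OF q_lim q_meas])
    qed (use q_lim q_le in auto)
    moreover have "integral\<^sup>L M (q i) = ((\<integral>t. f (X i) t \<partial>M) - (\<integral>t. f x t \<partial>M)) / (X i - x)" for i
      unfolding q_def using X(1) x by (subst integral_divide_zero, subst Bochner_Integration.integral_diff) (auto intro: int)
    ultimately show "((\<lambda>u. ((\<integral>t. f u t \<partial>M) - (\<integral>t. f x t \<partial>M)) / (u - x)) \<circ> X) \<longlonglongrightarrow> integral\<^sup>L M (f' x)"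
      by (simp add: comp_def)
  qed
  then show ?thesis
    using x by (simp add: has_field_derivative_iff at_within_open[OF x])
qed

text \<open>For t <= 1, |ln t| = 4 ln (t^(-1/4)) <= 4 t^(-1/4), and multiplying by t^(-1/2) leaves
  the exponent - 3/4, still integrable at 0. For t > 1 both factors are at most t.\<close>

lemma abs_ln_mult_powr_le:
  fixes t a :: real
  assumes "t > 0" "\<bar>a\<bar> \<le> 1 / 2"
  shows "\<bar>ln t\<bar> * t powr a \<le> 4 * t powr (- (3/4)) + t\<^sup>2"
proof (cases "t \<le> 1")
  case True
  have "\<bar>ln t\<bar> = 4 * ln (t powr (-1/4))"
    using True assms by (simp add: ln_powr)
  also have "\<dots> \<le> 4 * t powr (-1/4)"
    using assms by (intro mult_left_mono ln_bound) auto
  finally have "\<bar>ln t\<bar> * t powr a \<le> (4 * t powr (-1/4)) * t powr (-1/2)"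
    using True assms by (intro mult_mono powr_mono') auto
  also have "\<dots> = 4 * t powr (- (3/4))"
    by (simp flip: powr_add)
  finally show ?thesis
    by (simp add: add_increasing2)
next
  case False
  then have "\<bar>ln t\<bar> * t powr a \<le> t powr 1 * t powr 1"
    using assms ln_bound[of t] by (intro mult_mono powr_mono) auto
  also have "\<dots> = t\<^sup>2"
    using assms by (simp add: power2_eq_square)
  finally show ?thesis
    by (simp add: add_increasing)
qed

lemma integrable_half_line_ln_bound:
  "integrable half_line (\<lambda>t. (4 * t powr (- (3/4)) + t\<^sup>2) * exp (- t))"
proof -
  have "integrable half_line (\<lambda>t. t powr (1/4 - 1) * exp (- (1 * t)))"
    "integrable half_line (\<lambda>t. t powr (3 - 1) * exp (- (1 * t)))"
    by (rule integrable.intros[OF has_bochner_integral_Gamma]; simp)+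
  then have "integrable half_line (\<lambda>t. 4 * (t powr (1/4 - 1) * exp (- (1 * t))) + t powr (3 - 1) * exp (- (1 * t)))"
    by (intro Bochner_Integration.integrable_add integrable_mult_right)
  also have "?this \<longleftrightarrow> ?thesis"
    by (rule Bochner_Integration.integrable_cong) (auto simp: algebra_simps powr_numeral)
  finally show ?thesis .
qed

text \<open>The derivative at a = 0 of Gamma(a + 1), computed under the integral sign, equals
  Digamma 1. This is how Euler's constant enters the expansion of the Macdonald integral at
  0.\<close>

lemma has_bochner_integral_ln_exp:
  "has_bochner_integral half_line (\<lambda>t. ln t * exp (- t)) (- euler_mascheroni)"
proof -
  have int: "integrable half_line (\<lambda>t. t powr a * exp (- t))" "(\<integral>t. t powr a * exp (- t) \<partial>half_line) = Gamma (a + 1)"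
    if "a > -1" for a
    using has_bochner_integral_Gamma[of "a + 1" 1] that by (auto simp: has_bochner_integral_iff)
  have bound: "\<bar>ln t * t powr a * exp (- t)\<bar> \<le> (4 * t powr (- (3/4)) + t\<^sup>2) * exp (- t)"
    if "\<bar>a\<bar> \<le> 1 / 2" "t > 0" for a t :: real
    using abs_ln_mult_powr_le[OF that(2,1)] by (simp add: abs_mult)
  have "((\<lambda>a. \<integral>t. t powr a * exp (- t) \<partial>half_line) has_field_derivative
      (\<integral>t. ln t * t powr 0 * exp (- t) \<partial>half_line)) (at 0)"
    by (rule has_field_derivative_integral[where a = "-1/2" and b = "1/2",
          OF _ _ _ _ integrable_half_line_ln_bound])
       (auto intro!: derivative_eq_intros int bound)
  moreover have "((\<lambda>a. \<integral>t. t powr a * exp (- t) \<partial>half_line) has_field_derivative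
      Gamma 1 * Digamma 1) (at (0::real))"
  proof (rule has_field_derivative_transform_within_open)
    show "((\<lambda>a. Gamma (a + 1)) has_field_derivative Gamma 1 * Digamma 1) (at (0::real))"
      by (auto intro!: derivative_eq_intros)
      show "Gamma (a + 1) = (\<integral>t. t powr a * exp (- t) \<partial>half_line)" if "a \<in> {-1<..}" for a :: real
      using int(2)[of a] that by simp
  qed auto
  ultimately have "(\<integral>t. ln t * t powr 0 * exp (- t) \<partial>half_line) = - euler_mascheroni"
    using DERIV_unique by fastforce
  also have "(\<integral>t. ln t * t powr 0 * exp (- t) \<partial>half_line) = (\<integral>t. ln t * exp (- t) \<partial>half_line)"
    by (rule Bochner_Integration.integral_cong) auto
  finally have "(\<integral>t. ln t * exp (- t) \<partial>half_line) = - euler_mascheroni" .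
  moreover have "integrable half_line (\<lambda>t. ln t * exp (- t))"
  proof (rule Bochner_Integration.integrable_bound[OF integrable_half_line_ln_bound])
    show "AE t in half_line. norm (ln t * exp (- t)) \<le> norm ((4 * t powr (- (3/4)) + t\<^sup>2) * exp (- t))"
      using bound[of 0] by (intro AE_I2) (force intro: order_trans)
  qed measurable
  ultimately show ?thesis
    by (simp add: has_bochner_integral_iff)
qed

section \<open>The Macdonald integral\<close>

text \<open>In classical terms 2 y^((1 - j) / 2) K_(j-1)(2 sqrt y), so j = 1 is the case of
  interest; in this normalisation differentiation in y merely raises j, up to sign.\<close>

definition macdonald :: "nat \<Rightarrow> real \<Rightarrow> real" where
  "macdonald j y = (\<integral>t. (1 / t) ^ j * exp (- t - y / t) \<partial>half_line)"

lemma power_le_fact_mult_exp: "(x::real) \<ge> 0 \<Longrightarrow> x ^ j \<le> fact j * exp x"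
proof -
  assume "x \<ge> 0"
  have "(\<Sum>i\<in>{j}. inverse (fact i) *\<^sub>R x ^ i) \<le> (\<Sum>i. inverse (fact i) *\<^sub>R x ^ i)"
    using \<open>x \<ge> 0\<close> by (intro sum_le_suminf summable_exp_generic) auto
  then show ?thesis
    by (simp add: exp_def field_simps)
qed

text \<open>The pole at t = 0 is absorbed by the exponential through (d / t)^j <= j! exp (d / t).
  The bound is uniform in y >= d, as differentiation under the integral requires.\<close>

lemma macdonald_kernel_le:
  fixes d y t :: real
  assumes "0 < d" "d \<le> y" "0 < t"
  shows "(1 / t) ^ j * exp (- t - y / t) \<le> fact j / d ^ j * exp (- t)"
proof -
  have "(d / t) ^ j \<le> fact j * exp (d / t)"
    using power_le_fact_mult_exp[of "d / t" j] assms by simp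
  also have "\<dots> \<le> fact j * exp (y / t)"
    using assms by (intro mult_left_mono) (auto simp: divide_right_mono)
  finally have "(1 / t) ^ j \<le> fact j / d ^ j * exp (y / t)"
    using assms by (simp add: power_divide field_simps)
  then have "(1 / t) ^ j * exp (- t - y / t) \<le> fact j / d ^ j * exp (y / t) * exp (- t - y / t)"
    by (rule mult_right_mono) simp
  also have "\<dots> = fact j / d ^ j * exp (- t)"
    by (simp add: mult.assoc mult_exp_exp)
  finally show ?thesis .
qed

lemma integrable_exp_half_line: "integrable half_line (\<lambda>t. exp (- t))"
  by (rule integrable.intros[OF has_bochner_integral_exp])

lemma integrable_macdonald_kernel:
  assumes "y > 0"
  shows "integrable half_line (\<lambda>t. (1 / t) ^ j * exp (- t - y / t))"
proof (rule Bochner_Integration.integrable_bound)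
  show "integrable half_line (\<lambda>t. fact j / y ^ j * exp (- t))"
    by (intro integrable_mult_right integrable_exp_half_line)
  show "AE t in half_line. norm ((1 / t) ^ j * exp (- t - y / t)) \<le> norm (fact j / y ^ j * exp (- t))"
    using assms macdonald_kernel_le[of y y _ j] by (intro AE_I2) (auto simp: abs_mult)
qed measurable

lemma has_field_derivative_macdonald:
  assumes "y > 0"
  shows "(macdonald j has_field_derivative - macdonald (Suc j) y) (at y)"
proof -
  have "((\<lambda>y. \<integral>t. (1 / t) ^ j * exp (- t - y / t) \<partial>half_line) has_field_derivative
      (\<integral>t. - ((1 / t) ^ Suc j * exp (- t - y / t)) \<partial>half_line)) (at y)"
  proof (rule has_field_derivative_integral)
    show "y \<in> {y / 2<..<2 * y}"
      using assms by auto
    show "integrable half_line (\<lambda>t. fact (Suc j) / (y / 2) ^ Suc j * exp (- t))"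
      by (intro integrable_mult_right integrable_exp_half_line)
    fix x assume x: "x \<in> {y / 2<..<2 * y}"
    then show "integrable half_line (\<lambda>t. (1 / t) ^ j * exp (- t - x / t))"
      using assms by (intro integrable_macdonald_kernel) auto
    fix t :: real assume "t \<in> space half_line"
    then have "t > 0" by simp
    then show "\<bar>- ((1 / t) ^ Suc j * exp (- t - x / t))\<bar> \<le> fact (Suc j) / (y / 2) ^ Suc j * exp (- t)"
      using macdonald_kernel_le[of "y / 2" x t "Suc j"] x assms by (simp add: abs_mult del: fact_Suc power_Suc)
    show "((\<lambda>x. (1 / t) ^ j * exp (- t - x / t)) has_field_derivative
        - ((1 / t) ^ Suc j * exp (- t - x / t))) (at x)"
      using \<open>t > 0\<close> by (auto intro!: derivative_eq_intros)
  qed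
  then show ?thesis
    by (simp add: macdonald_def[abs_def])
qed

text \<open>The substitution t -> y / t preserves t + y / t and has Jacobian y / t^2. Combined with
  the derivative rule this is the equation (y f')' = f for f = \<open>macdonald 1\<close>.\<close>

lemma macdonald_2:
  assumes "y > 0"
  shows "y * macdonald 2 y = macdonald 0 y"
proof -
  have "has_bochner_integral half_line (\<lambda>t. exp (- t - y / t)) (macdonald 0 y)"
    using integrable_macdonald_kernel[OF assms, of 0] by (simp add: has_bochner_integral_iff macdonald_def)
  then have "has_bochner_integral half_line (\<lambda>t. (y / t\<^sup>2) *\<^sub>R exp (- (y / t) - y / (y / t))) (macdonald 0 y)"
    using assms by (subst half_line_inversion) auto
  also have "?this \<longleftrightarrow> has_bochner_integral half_line (\<lambda>t. y * ((1 / t) ^ 2 * exp (- t - y / t))) (macdonald 0 y)"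
    using assms by (intro has_bochner_integral_cong) (auto simp: power_divide)
  finally show ?thesis
    by (simp add: has_bochner_integral_iff macdonald_def)
qed

lemma integrable_ln_macdonald_kernel:
  assumes "y > 0"
  shows "integrable half_line (\<lambda>t. ln t * ((1 / t) ^ j * exp (- t - y / t)))"
proof (rule Bochner_Integration.integrable_bound)
  show "integrable half_line (\<lambda>t. fact j / y ^ j * (ln t * exp (- t)))"
    by (intro integrable_mult_right integrable.intros[OF has_bochner_integral_ln_exp])
  show "AE t in half_line. norm (ln t * ((1 / t) ^ j * exp (- t - y / t))) \<le> norm (fact j / y ^ j * (ln t * exp (- t)))"
  proof (rule AE_I2)
    fix t :: real assume "t \<in> space half_line"
    then have "\<bar>ln t\<bar> * ((1 / t) ^ j * exp (- t - y / t)) \<le> \<bar>ln t\<bar> * (fact j / y ^ j * exp (- t))"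
      using assms by (intro mult_left_mono macdonald_kernel_le) auto
    then show "norm (ln t * ((1 / t) ^ j * exp (- t - y / t))) \<le> norm (fact j / y ^ j * (ln t * exp (- t)))"
      using assms \<open>t \<in> _\<close> by (simp add: abs_mult mult_ac)
  qed
qed measurable

text \<open>
  The substitution \<open>t \<mapsto> y / t\<close> and an integration by parts give two relations between
  \<open>\<integral> ln t exp (- t - y / t) dt\<close> and \<open>\<integral> ln t exp (- t - y / t) / t\<^sup>2 dt\<close>; the latter is eliminated.
\<close>

lemma macdonald_1_plus_ln:
  assumes "y > 0"
  shows "macdonald 1 y + ln y * macdonald 0 y = 2 * (\<integral>t. ln t * exp (- t - y / t) \<partial>half_line)"
proof -
  define \<Lambda> where "\<Lambda> = (\<lambda>j. \<integral>t. ln t * ((1 / t) ^ j * exp (- t - y / t)) \<partial>half_line)"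
  note int = integrable_macdonald_kernel[OF assms] integrable_ln_macdonald_kernel[OF assms]
  have "has_bochner_integral half_line (\<lambda>t. ln t * exp (- t - y / t)) (\<Lambda> 0)"
    using int(2)[of 0] by (simp add: has_bochner_integral_iff \<Lambda>_def)
  then have "has_bochner_integral half_line (\<lambda>t. (y / t\<^sup>2) *\<^sub>R (ln (y / t) * exp (- (y / t) - y / (y / t)))) (\<Lambda> 0)"
    using assms by (subst half_line_inversion) auto
  also have "?this \<longleftrightarrow> has_bochner_integral half_line
      (\<lambda>t. y * ln y * ((1 / t) ^ 2 * exp (- t - y / t)) - y * (ln t * ((1 / t) ^ 2 * exp (- t - y / t)))) (\<Lambda> 0)"
  proof (rule has_bochner_integral_cong)
    fix t assume "t \<in> space half_line"
    then have "t > 0" by simp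
    moreover from this have "- (y / t) - y / (y / t) = - t - y / t"
      using assms by simp
    ultimately show "(y / t\<^sup>2) *\<^sub>R (ln (y / t) * exp (- (y / t) - y / (y / t)))
        = y * ln y * ((1 / t) ^ 2 * exp (- t - y / t)) - y * (ln t * ((1 / t) ^ 2 * exp (- t - y / t)))"
      using assms by (simp only: real_scaleR_def) (simp add: ln_div power_divide algebra_simps)
  qed auto
  finally have "\<Lambda> 0 = y * ln y * macdonald 2 y - y * \<Lambda> 2"
    using int by (simp add: has_bochner_integral_iff macdonald_def \<Lambda>_def)
  then have 1: "\<Lambda> 0 = ln y * macdonald 0 y - y * \<Lambda> 2"
    using macdonald_2[OF assms] by (simp add: algebra_simps)
  \<comment> \<open>\<open>?f\<close> is the derivative of ln t exp (- t - y / t), which tends to 0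
    at both ends.\<close>
  let ?f = "\<lambda>t. (1 / t) ^ 1 * exp (- t - y / t) - ln t * ((1 / t) ^ 0 * exp (- t - y / t))
      + y * (ln t * ((1 / t) ^ 2 * exp (- t - y / t)))"
  have "integral\<^sup>L half_line ?f = 0 - 0"
  proof (rule half_line_FTC)
    show "((\<lambda>t. ln t * exp (- t - y / t)) has_field_derivative ?f t) (at t)" if "t > 0" for t
      using that by (auto intro!: derivative_eq_intros simp: power_divide field_simps power2_eq_square)
    show "isCont ?f t" if "t > 0" for t
      using that by (auto intro!: continuous_intros)
    show "integrable half_line ?f"
      by (intro Bochner_Integration.integrable_add Bochner_Integration.integrable_diff integrable_mult_right int)
    show "((\<lambda>t. ln t * exp (- t - y / t)) \<longlongrightarrow> 0) (at_right 0)"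
      using assms by real_asymp
    show "((\<lambda>t. ln t * exp (- t - y / t)) \<longlongrightarrow> 0) at_top"
      using assms by real_asymp
  qed
  also have "integral\<^sup>L half_line ?f = macdonald 1 y - \<Lambda> 0 + y * \<Lambda> 2"
    unfolding macdonald_def \<Lambda>_def
    by (simp only: Bochner_Integration.integral_add Bochner_Integration.integral_diff
      Bochner_Integration.integrable_diff integrable_mult_right int integral_mult_right_zero)
  finally show ?thesis
    using 1 by (simp add: \<Lambda>_def)
qed

text \<open>The lower bound uses 1 - sqrt u <= exp (- u) at u = y / t. The simpler 1 - u would lead
  to the divergent integral of exp (- t) / t; the square root gives Gamma(1/2), and the rate sqrt y
  still beats ln y.\<close>

lemma macdonald_0_bounds:
  assumes "y > 0"
  shows "macdonald 0 y \<le> 1" "1 - sqrt y * Gamma (1 / 2) \<le> macdonald 0 y"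
proof -
  have int: "integrable half_line (\<lambda>t. exp (- t - y / t))"
    using integrable_macdonald_kernel[OF assms, of 0] by simp
  have "macdonald 0 y \<le> integral\<^sup>L half_line (\<lambda>t. exp (- t))"
    unfolding macdonald_def using assms int
    by (intro integral_mono integrable_exp_half_line) auto
  then show "macdonald 0 y \<le> 1"
    using has_bochner_integral_exp by (simp add: has_bochner_integral_iff)
  have G: "has_bochner_integral half_line (\<lambda>t. t powr (1 / 2 - 1) * exp (- (1 * t))) (Gamma (1 / 2) / 1 powr (1 / 2))"
    by (rule has_bochner_integral_Gamma) auto
  have *: "has_bochner_integral half_line (\<lambda>t. exp (- t) - sqrt y * (t powr (1 / 2 - 1) * exp (- (1 * t))))
      (1 - sqrt y * (Gamma (1 / 2) / 1 powr (1 / 2)))"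
    by (intro has_bochner_integral_diff has_bochner_integral_exp has_bochner_integral_mult_right G)
  have "integral\<^sup>L half_line (\<lambda>t. exp (- t) - sqrt y * (t powr (1 / 2 - 1) * exp (- (1 * t)))) \<le> macdonald 0 y"
    unfolding macdonald_def
  proof (rule integral_mono)
    show "integrable half_line (\<lambda>t. exp (- t) - sqrt y * (t powr (1 / 2 - 1) * exp (- (1 * t))))"
      using * by (simp add: has_bochner_integral_iff)
    fix t :: real assume "t \<in> space half_line"
    then have t: "t > 0" by simp
    have "1 - sqrt (y / t) \<le> exp (- (y / t))"
    proof (cases "y / t \<le> 1")
      case True
      have "sqrt (y / t) * sqrt (y / t) \<le> sqrt (y / t) * 1"
        using True assms t by (intro mult_left_mono) auto
      then have "y / t \<le> sqrt (y / t)"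
        using assms t by (simp del: real_sqrt_divide)
      then show ?thesis
        using exp_ge_add_one_self[of "- (y / t)"] by linarith
    next
      case False
      then have "sqrt (y / t) > 1" by simp
      then show ?thesis
        by (smt (verit) exp_gt_zero)
    qed
    then have "(1 - sqrt (y / t)) * exp (- t) \<le> exp (- (y / t)) * exp (- t)"
      by (rule mult_right_mono) simp
    moreover have "t powr (1 / 2 - 1) = 1 / sqrt t"
      using t powr_minus_divide[of t "1 / 2"] by (simp add: powr_half_sqrt)
    ultimately show "exp (- t) - sqrt y * (t powr (1 / 2 - 1) * exp (- (1 * t))) \<le> (1 / t) ^ 0 * exp (- t - y / t)"
      by (simp add: real_sqrt_divide algebra_simps mult_exp_exp)
  qed (use int in auto)
  then show "1 - sqrt y * Gamma (1 / 2) \<le> macdonald 0 y"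
    using * by (simp add: has_bochner_integral_iff)
qed

lemma tendsto_ln_mult_macdonald_0:
  "((\<lambda>y. ln y * (1 - macdonald 0 y)) \<longlongrightarrow> 0) (at_right 0)"
proof (rule Lim_null_comparison)
  show "\<forall>\<^sub>F y in at_right 0. norm (ln y * (1 - macdonald 0 y)) \<le> \<bar>ln y\<bar> * (sqrt y * Gamma (1 / 2))"
    using eventually_at_right_less[of 0]
  proof eventually_elim
    case (elim y)
    then have "\<bar>1 - macdonald 0 y\<bar> \<le> sqrt y * Gamma (1 / 2)"
      using macdonald_0_bounds[of y] by auto
    then show ?case
      by (simp add: abs_mult mult_left_mono)
  qed
  have "((\<lambda>y. \<bar>ln y\<bar> * sqrt y) \<longlongrightarrow> 0) (at_right (0::real))"
    by real_asymp
  from tendsto_mult_left_zero[OF this, of "Gamma (1 / 2)"]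
  show "((\<lambda>y. \<bar>ln y\<bar> * (sqrt y * Gamma (1 / 2))) \<longlongrightarrow> 0) (at_right (0::real))"
    by (simp add: mult.assoc)
qed

lemma tendsto_macdonald_0: "(macdonald 0 \<longlongrightarrow> 1) (at_right 0)"
proof (rule tendsto_sandwich)
  show "\<forall>\<^sub>F y in at_right 0. macdonald 0 y \<le> 1" "\<forall>\<^sub>F y in at_right 0. 1 - sqrt y * Gamma (1 / 2) \<le> macdonald 0 y"
    using eventually_at_right_less[of 0] by (eventually_elim; use macdonald_0_bounds in auto)+
  have "((\<lambda>y. 1 - sqrt y * Gamma (1 / 2)) \<longlongrightarrow> 1 - sqrt 0 * Gamma (1 / 2)) (at_right 0)"
    by (intro tendsto_intros)
  then show "((\<lambda>y. 1 - sqrt y * Gamma (1 / 2)) \<longlongrightarrow> 1) (at_right 0)"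
    by simp
qed simp

text \<open>The kernel of \<open>macdonald 1\<close> has the non-integrable limit exp (- t) / t as y
  tends to 0. By \<open>macdonald_1_plus_ln\<close> it is traded for ln t exp (- t - y / t), to
  which dominated convergence applies.\<close>

lemma tendsto_macdonald_1_plus_ln:
  "((\<lambda>y. macdonald 1 y + ln y) \<longlongrightarrow> - 2 * euler_mascheroni) (at_right 0)"
proof -
  have "((\<lambda>y. \<integral>t. ln t * exp (- t - y / t) \<partial>half_line) \<longlongrightarrow> (\<integral>t. ln t * exp (- t) \<partial>half_line)) (at 0 within {0<..})"
    unfolding tendsto_at_iff_sequentially comp_def
  proof (intro allI impI)
    fix X :: "nat \<Rightarrow> real" assume X: "\<forall>i. X i \<in> {0<..} - {0}" "X \<longlonglongrightarrow> 0"
    show "(\<lambda>i. \<integral>t. ln t * exp (- t - X i / t) \<partial>half_line) \<longlonglongrightarrow> (\<integral>t. ln t * exp (- t) \<partial>half_line)"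
    proof (rule integral_dominated_convergence)
      show "integrable half_line (\<lambda>t. \<bar>ln t * exp (- t)\<bar>)"
        by (intro integrable_abs integrable.intros[OF has_bochner_integral_ln_exp])
      show "AE t in half_line. (\<lambda>i. ln t * exp (- t - X i / t)) \<longlonglongrightarrow> ln t * exp (- t)"
      proof (rule AE_I2)
        fix t :: real assume "t \<in> space half_line"
        then have "(\<lambda>i. ln t * exp (- t - X i / t)) \<longlonglongrightarrow> ln t * exp (- t - 0 / t)"
          by (intro tendsto_intros X) auto
        then show "(\<lambda>i. ln t * exp (- t - X i / t)) \<longlonglongrightarrow> ln t * exp (- t)"
          by simp
      qed
      show "AE t in half_line. norm (ln t * exp (- t - X i / t)) \<le> \<bar>ln t * exp (- t)\<bar>" for i
      proof (rule AE_I2)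
        fix t :: real assume "t \<in> space half_line"
        then have "exp (- t - X i / t) \<le> exp (- t)"
          using X(1) by (auto intro: less_imp_le)
        then show "norm (ln t * exp (- t - X i / t)) \<le> \<bar>ln t * exp (- t)\<bar>"
          by (simp add: abs_mult mult_left_mono)
      qed
    qed measurable
  qed
  also have "(\<integral>t. ln t * exp (- t) \<partial>half_line) = - euler_mascheroni"
    using has_bochner_integral_ln_exp by (simp add: has_bochner_integral_iff)
  finally have "((\<lambda>y. 2 * (\<integral>t. ln t * exp (- t - y / t) \<partial>half_line) + ln y * (1 - macdonald 0 y))
      \<longlongrightarrow> 2 * (- euler_mascheroni) + 0) (at_right 0)"
    by (intro tendsto_add tendsto_mult_left tendsto_ln_mult_macdonald_0)
  also have "?this \<longleftrightarrow> ?thesis"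
  proof (rule filterlim_cong)
    show "\<forall>\<^sub>F y in at_right 0. 2 * (\<integral>t. ln t * exp (- t - y / t) \<partial>half_line) + ln y * (1 - macdonald 0 y)
        = macdonald 1 y + ln y"
      using eventually_at_right_less[of 0]
      by eventually_elim (use macdonald_1_plus_ln in \<open>auto simp: algebra_simps\<close>)
  qed auto
  finally show ?thesis .
qed

text \<open>Multiplying the coefficient of index k + 1 by (k + 1)^2 returns that of index k, except
  that the harmonic number exceeds its predecessor by 1 / (k + 1); these excesses sum to
  \<open>bessel_series 1\<close>. Doubled, that term cancels the inhomogeneity produced by ln y
  \<open>bessel_series 0 y\<close>.\<close>

lemma digamma_series_derivatives:
  obtains B' :: "real \<Rightarrow> real" where
    "\<And>y. (digamma_series has_field_derivative B' y) (at y)"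
    "\<And>y. ((\<lambda>y. y * B' y) has_field_derivative digamma_series y + bessel_series 1 y) (at y)"
proof
  let ?c = "\<lambda>k. (harm k - euler_mascheroni) / (fact k)\<^sup>2 :: real"
  define e where "e = (\<lambda>k. real k * ?c k)"
  have s: "summable (\<lambda>k. ?c k * y ^ k)" for y :: real
    using summable_digamma_series[of y] by simp
  have B: "digamma_series = (\<lambda>y. \<Sum>k. ?c k * y ^ k)"
    by (simp add: digamma_series_def fun_eq_iff)
  show "(digamma_series has_field_derivative (\<Sum>k. diffs ?c k * y ^ k)) (at y)" for y
    unfolding B by (rule termdiffs_strong_converges_everywhere[OF s])
  have "(\<lambda>k. y * (diffs ?c k * y ^ k)) sums (y * (\<Sum>k. diffs ?c k * y ^ k))" for y
    by (intro sums_mult summable_sums termdiff_converges_all s)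
  then have e_sums: "(\<lambda>k. e k * y ^ k) sums (y * (\<Sum>k. diffs ?c k * y ^ k))" for y
    using sums_Suc[of "\<lambda>k. e k * y ^ k" "y * (\<Sum>k. diffs ?c k * y ^ k)"]
    by (simp add: e_def diffs_def mult_ac)
  have "diffs e k = ?c k + 1 / (fact k * fact (k + 1))" for k
  proof -
    have "diffs e k = (real (Suc k))\<^sup>2 * ?c (Suc k)"
      by (simp add: diffs_def e_def power2_eq_square)
    also have "\<dots> = (harm (Suc k) - euler_mascheroni) / (fact k)\<^sup>2"
      by (simp add: power_mult_distrib del: of_nat_Suc)
    also have "\<dots> = ?c k + 1 / (fact k * fact (k + 1))"
      by (simp add: harm_Suc field_simps power2_eq_square del: of_nat_Suc)
    finally show ?thesis .
  qed
  then have "(\<lambda>k. diffs e k * y ^ k) sums (digamma_series y + bessel_series 1 y)" for y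
    using sums_add[OF summable_sums[OF s] summable_sums[OF summable_bessel_series[of 1]]]
    unfolding B bessel_series_def by (simp add: algebra_simps)
  moreover have "((\<lambda>y. \<Sum>k. e k * y ^ k) has_field_derivative (\<Sum>k. diffs e k * y ^ k)) (at y)" for y
    by (rule termdiffs_strong_converges_everywhere) (use e_sums sums_summable in blast)
  ultimately show "((\<lambda>y. y * (\<Sum>k. diffs ?c k * y ^ k)) has_field_derivative digamma_series y + bessel_series 1 y) (at y)" for y
    using sums_unique[OF e_sums] sums_unique by (metis (no_types, lifting) ext)
qed

text \<open>The difference D of the two sides solves the homogeneous equation. D and y D' tend to 0
  at the origin, which makes the Wronskian with \<open>bessel_series 0\<close> vanish; D is then a
  constant multiple of that function, and D -> 0 forces the constant to be 0.\<close>

lemma macdonald_1_conv_series: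
  assumes "y > 0"
  shows "macdonald 1 y = 2 * digamma_series y - ln y * bessel_series 0 y"
proof -
  obtain B' :: "real \<Rightarrow> real" where
    dB: "\<And>y. (digamma_series has_field_derivative B' y) (at y)"
    and dyB': "\<And>y. ((\<lambda>y. y * B' y) has_field_derivative digamma_series y + bessel_series 1 y) (at y)"
    using digamma_series_derivatives by blast
  define D where "D = (\<lambda>y. macdonald 1 y - (2 * digamma_series y - ln y * bessel_series 0 y))"
  define E where "E = (\<lambda>y. - macdonald 0 y - (2 * (y * B' y) - bessel_series 0 y - ln y * (y * bessel_series 1 y)))"
  have rec: "bessel_series 0 y = bessel_series 1 y + y * bessel_series 2 y" for y :: real
    using bessel_series_recurrence[of 0 y] by (simp add: numeral_2_eq_2)
  have dS0: "(bessel_series 0 has_field_derivative bessel_series 1 y) (at y)" for y :: real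
    using has_field_derivative_bessel_series[of 0 y] by simp
  have dS1: "((\<lambda>y. y * bessel_series 1 y) has_field_derivative bessel_series 0 y) (at y)" for y :: real
    unfolding rec[of y]
    by (auto intro!: derivative_eq_intros simp: numeral_2_eq_2)
  have dD: "(D has_field_derivative E y / y) (at y)" if "y > 0" for y
  proof -
    have "(D has_field_derivative - macdonald (Suc 1) y
        - (2 * B' y - (ln y * bessel_series 1 y + 1 / y * bessel_series 0 y))) (at y)"
      unfolding D_def
      by (rule derivative_eq_intros has_field_derivative_macdonald dB dS0 that refl)+ simp
    moreover have "macdonald (Suc 1) y = macdonald 0 y / y"
      using macdonald_2[OF that] that by (simp add: field_simps numeral_2_eq_2)
    ultimately show ?thesis
      using that by (simp add: E_def field_simps)
  qed
  have dE: "(E has_field_derivative D y) (at y)" if "y > 0" for y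
  proof -
    have "(E has_field_derivative macdonald (Suc 0) y - (2 * (digamma_series y + bessel_series 1 y)
        - bessel_series 1 y - (ln y * bessel_series 0 y + 1 / y * (y * bessel_series 1 y)))) (at y)"
      unfolding E_def
      by (rule derivative_eq_intros has_field_derivative_macdonald dyB' dS0 dS1 that refl)+ simp
    then show ?thesis
      using that by (simp add: D_def field_simps)
  qed
  have const: "\<exists>c. \<forall>y\<in>{0<..}. f y = c" if "\<And>y. y > 0 \<Longrightarrow> (f has_field_derivative 0) (at y)" for f :: "real \<Rightarrow> real"
    using that by (intro has_field_derivative_zero_constant) (auto intro: has_field_derivative_at_within)
  \<comment> \<open>\<open>E = y D'\<close>, and \<open>W\<close> is \<open>y\<close> times the Wronskian of \<open>D\<close> with the solution \<open>bessel_series 0\<close>, hence constant.\<close>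
  define W where "W = (\<lambda>y. E y * bessel_series 0 y - D y * (y * bessel_series 1 y))"
  have "(W has_field_derivative 0) (at y)" if "y > 0" for y
  proof -
    have "(W has_field_derivative (D y * bessel_series 0 y + bessel_series 1 y * E y)
        - (E y / y * (y * bessel_series 1 y) + bessel_series 0 y * D y)) (at y)"
      unfolding W_def by (intro DERIV_diff DERIV_mult dD dE dS0 dS1 that)
    then show ?thesis
      using that by (simp add: field_simps)
  qed
  then obtain w where w: "\<And>y. y > 0 \<Longrightarrow> W y = w"
    using const[of W] by auto
  have cont: "(f \<longlongrightarrow> f 0) (at_right 0)" if "\<And>y. (f has_field_derivative f' y) (at y)" for f f' :: "real \<Rightarrow> real"
    using DERIV_isCont[OF that[of 0]] unfolding isCont_def by (rule tendsto_within_subset) simp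
  have lnyS1: "((\<lambda>y::real. ln y * (y * bessel_series 1 y)) \<longlongrightarrow> 0) (at_right 0)"
  proof -
    have "((\<lambda>y::real. ln y * y) \<longlongrightarrow> 0) (at_right 0)"
      by real_asymp
    from tendsto_mult[OF this cont[OF has_field_derivative_bessel_series[of 1]]] show ?thesis
      by (simp add: mult.assoc)
  qed
  have lnS0: "((\<lambda>y::real. ln y * (bessel_series 0 y - 1)) \<longlongrightarrow> 0) (at_right 0)"
  proof -
    have "((\<lambda>y::real. ln y * y) \<longlongrightarrow> 0) (at_right 0)"
      by real_asymp
    moreover have "((\<lambda>y::real. (bessel_series 0 y - 1) / y) \<longlongrightarrow> bessel_series 1 0) (at_right 0)"
      using dS0[of 0] unfolding has_field_derivative_iff by (auto intro: tendsto_within_subset)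
    ultimately have "((\<lambda>y::real. (ln y * y) * ((bessel_series 0 y - 1) / y)) \<longlongrightarrow> 0 * bessel_series 1 0) (at_right 0)"
      by (rule tendsto_mult)
    also have "?this \<longleftrightarrow> ?thesis"
    proof (rule filterlim_cong)
      show "\<forall>\<^sub>F y::real in at_right 0. (ln y * y) * ((bessel_series 0 y - 1) / y) = ln y * (bessel_series 0 y - 1)"
        using eventually_at_right_less[of 0] by eventually_elim auto
    qed auto
    finally show ?thesis .
  qed
  have digamma_0: "digamma_series (0::real) = - euler_mascheroni"
    unfolding digamma_series_def by (subst suminf_finite[of "{0}"]) (auto simp: harm_def)
  \<comment> \<open>The limits - 1 from \<open>macdonald 0\<close> and + 1 from
    \<open>bessel_series 0\<close> cancel.\<close>
  have E0: "(E \<longlongrightarrow> 0) (at_right 0)"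
  proof -
    have "(E \<longlongrightarrow> - 1 - (2 * (0 * B' 0) - bessel_series 0 0 - 0)) (at_right 0)"
      unfolding E_def
      by (intro tendsto_diff tendsto_minus tendsto_mult_left tendsto_macdonald_0 cont[OF dyB'] cont[OF dS0] lnyS1)
    then show ?thesis by simp
  qed
  \<comment> \<open>D is regrouped so that the logarithms meet only convergent combinations; the two
    contributions 2 \<open>euler_mascheroni\<close> cancel.\<close>
  have D0: "(D \<longlongrightarrow> 0) (at_right 0)"
  proof -
    have "((\<lambda>y. (macdonald 1 y + ln y) - 2 * digamma_series y + ln y * (bessel_series 0 y - 1))
       \<longlongrightarrow> - 2 * euler_mascheroni - 2 * digamma_series 0 + 0) (at_right 0)"
      by (intro tendsto_diff tendsto_add tendsto_mult_left tendsto_macdonald_1_plus_ln cont[OF dB] lnS0)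
    then show ?thesis
      by (simp add: digamma_0 D_def algebra_simps)
  qed
  have unique: "c = l" if "\<And>y. y > 0 \<Longrightarrow> f y = c" "(f \<longlongrightarrow> l) (at_right 0)" for f :: "real \<Rightarrow> real" and c l
  proof -
    have "((\<lambda>_. c) \<longlongrightarrow> l) (at_right (0::real))"
      using that(2) by (rule Lim_transform_eventually)
        (use that(1) eventually_at_right_less[of "0::real"] in \<open>auto elim!: eventually_mono\<close>)
    then show ?thesis
      by (simp add: tendsto_const_iff)
  qed
  have "(W \<longlongrightarrow> 0 * bessel_series 0 0 - 0 * (0 * bessel_series 1 0)) (at_right 0)"
    unfolding W_def by (intro tendsto_diff tendsto_mult[of _ 0] E0 D0 cont[OF dS0] cont[OF dS1])
  then have "w = 0"
    using unique[OF w] by simp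
  have pos: "bessel_series 0 y \<ge> 1" if "y \<ge> 0" for y :: real
  proof -
    have "(\<Sum>k\<in>{0}. 1 / (fact k * fact (k + 0)) * y ^ k) \<le> bessel_series 0 y"
      unfolding bessel_series_def using that
      by (intro sum_le_suminf summable_bessel_series) auto
    then show ?thesis by simp
  qed
  have "((\<lambda>y. D y / bessel_series 0 y) has_field_derivative 0) (at y)" if "y > 0" for y
  proof -
    have "((\<lambda>y. D y / bessel_series 0 y) has_field_derivative
        (E y / y * bessel_series 0 y - D y * bessel_series 1 y) / (bessel_series 0 y * bessel_series 0 y)) (at y)"
      using pos[of y] that by (intro DERIV_divide dD dS0) auto
    also have "E y / y * bessel_series 0 y - D y * bessel_series 1 y = W y / y"
      using that by (simp add: W_def field_simps)
    finally show ?thesis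
      using w[OF that] \<open>w = 0\<close> by simp
  qed
  then obtain d where d: "\<And>y. y > 0 \<Longrightarrow> D y / bessel_series 0 y = d"
    using const[of "\<lambda>y. D y / bessel_series 0 y"] by auto
  have "((\<lambda>y. D y / bessel_series 0 y) \<longlongrightarrow> 0 / bessel_series 0 0) (at_right 0)"
    by (intro tendsto_divide D0 cont[OF dS0]) auto
  then have "d = 0"
    using unique[OF d] by simp
  then have "D y = 0"
    using d[OF assms] pos[of y] assms by simp
  then show ?thesis
    by (simp add: D_def)
qed

section \<open>Evaluation of the integral\<close>

interpretation half_line_pair: pair_sigma_finite half_line half_line ..

lemma borel_measurable_bessel_series [measurable]: "bessel_series m \<in> borel_measurable (borel :: real measure)"
  by (intro borel_measurable_continuous_onI continuous_on_bessel_series continuous_on_id)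

lemma has_bochner_integral_power_exp:
  assumes "a > 0"
  shows "has_bochner_integral half_line (\<lambda>t. t ^ n * exp (- (a * t))) (fact n / a ^ Suc n)"
proof -
  have "has_bochner_integral half_line (\<lambda>t. t powr (real (Suc n) - 1) * exp (- (a * t)))
      (Gamma (real (Suc n)) / a powr (real (Suc n)))"
    using assms by (intro has_bochner_integral_Gamma) auto
  also have "Gamma (real (Suc n)) = fact n"
    using Gamma_fact[of n, where 'a = real] by (simp add: add.commute)
  also have "a powr (real (Suc n)) = a ^ Suc n"
    using assms by (rule powr_realpow)
  also have "has_bochner_integral half_line (\<lambda>t. t powr (real (Suc n) - 1) * exp (- (a * t))) (fact n / a ^ Suc n)
      \<longleftrightarrow> ?thesis"
    by (rule has_bochner_integral_cong) (auto simp: powr_realpow)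
  finally show ?thesis .
qed

text \<open>The Weber integral, term by term: the moment (k + 1)! / t^(k + 2) cancels the factor (k
  + 1)! of the coefficient and leaves the exponential series of - y / t, divided by t^2. Absolute
  values give the same series at |y| / t, which justifies the exchange.\<close>

lemma laplace_bessel_series:
  fixes y t :: real
  assumes "t > 0"
  shows "has_bochner_integral half_line (\<lambda>s. s * exp (- (t * s)) * bessel_series 1 (- (s * y))) (exp (- (y / t)) / t\<^sup>2)"
proof -
  define c where "c = (\<lambda>k. (- y) ^ k / (fact k * fact (k + 1)))"
  define f where "f = (\<lambda>k s. c k * (s ^ (k + 1) * exp (- (t * s))))"
  have moment: "has_bochner_integral half_line (\<lambda>s. s ^ (k + 1) * exp (- (t * s))) (fact (k + 1) / t ^ (k + 2))" for k
    using has_bochner_integral_power_exp[OF assms, of "k + 1"] by simp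
  have int: "integrable half_line (f k)" for k
    unfolding f_def by (intro integrable_mult_right integrable.intros[OF moment])
  have c_moment: "c k * (fact (k + 1) / t ^ (k + 2)) = (- y / t) ^ k /\<^sub>R fact k / t\<^sup>2" for k
    unfolding c_def power_divide[of "- y" t]
    using assms by (simp add: power2_eq_square field_simps del: fact_Suc)
  have int_f: "integral\<^sup>L half_line (f k) = (- y / t) ^ k /\<^sub>R fact k / t\<^sup>2" for k
    unfolding c_moment[symmetric] f_def using moment[of k] by (simp add: has_bochner_integral_iff del: fact_Suc)
  have norm_f: "(\<integral>s. norm (f k s) \<partial>half_line) = norm ((- y / t) ^ k /\<^sub>R fact k / t\<^sup>2)" for k
  proof -
    have "(\<integral>s. norm (f k s) \<partial>half_line) = (\<integral>s. \<bar>c k\<bar> * (s ^ (k + 1) * exp (- (t * s))) \<partial>half_line)"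
      by (rule Bochner_Integration.integral_cong) (auto simp: f_def abs_mult)
    also have "\<dots> = \<bar>c k\<bar> * (fact (k + 1) / t ^ (k + 2))"
      using moment[of k] by (simp add: has_bochner_integral_iff del: fact_Suc)
    also have "\<dots> = norm (c k * (fact (k + 1) / t ^ (k + 2)))"
      using assms by (simp add: abs_mult del: fact_Suc)
    finally show ?thesis
      by (simp only: c_moment)
  qed
  have f_sums: "(\<lambda>k. f k s) sums (s * exp (- (t * s)) * bessel_series 1 (- (s * y)))" for s
  proof -
    have "f k s = s * exp (- (t * s)) * (1 / (fact k * fact (k + 1)) * (- (s * y)) ^ k)" for k
      unfolding f_def c_def mult_minus_right[symmetric] power_mult_distrib by simp
    then show ?thesis
      unfolding bessel_series_def by (simp only:) (intro sums_mult summable_sums summable_bessel_series)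
  qed
  have summ: "AE s in half_line. summable (\<lambda>k. norm (f k s))"
  proof (rule AE_I2)
    fix s :: real assume "s \<in> space half_line"
    have "norm (f k s) = s * exp (- (t * s)) * (1 / (fact k * fact (k + 1)) * \<bar>s * y\<bar> ^ k)" for k
      using \<open>s \<in> _\<close> by (simp add: f_def c_def abs_mult power_abs mult_ac power_mult_distrib del: fact_Suc)
    then show "summable (\<lambda>k. norm (f k s))"
      by (simp only:) (intro summable_mult summable_bessel_series)
  qed
  have exp_sums: "(\<lambda>k. (- y / t) ^ k /\<^sub>R fact k / t\<^sup>2) sums (exp (- y / t) / t\<^sup>2)"
    by (intro sums_divide exp_converges)
  have "summable (\<lambda>k. norm ((- y / t) ^ k /\<^sub>R fact k / t\<^sup>2))"
    using summable_norm_exp[of "- y / t"] by (simp add: norm_divide summable_divide)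
  then have summ': "summable (\<lambda>k. \<integral>s. norm (f k s) \<partial>half_line)"
    by (simp only: norm_f)
  have "integral\<^sup>L half_line (\<lambda>s. \<Sum>k. f k s) = exp (- y / t) / t\<^sup>2"
    using sums_integral[OF int summ summ'] exp_sums unfolding int_f by (rule sums_unique2)
  with integrable_suminf[OF int summ summ'] show ?thesis
    using sums_unique[OF f_sums] by (simp add: has_bochner_integral_iff)
qed

text \<open>The bound |J_1| <= 1 read at u = 2 sqrt x, where J_1(u) = sqrt x
  \<open>bessel_series 1 (- x)\<close>.\<close>

lemma abs_bessel_series_1_le:
  fixes x :: real
  assumes "x > 0"
  shows "\<bar>bessel_series 1 (- x)\<bar> \<le> 1 / sqrt x"
proof -
  have "\<bar>sqrt x * bessel_series 1 (- x)\<bar> \<le> 1"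
    using abs_bessel_j_1_le[of "2 * sqrt x"] assms by (simp add: bessel_j_def)
  then show ?thesis
    using assms by (simp add: abs_mult field_simps)
qed

lemma integrable_half_line_powr:
  "integrable half_line (\<lambda>s. (1 + s) powr (- (3 / 2)))"
proof -
  have "set_integrable lborel (einterval (ereal 0) \<infinity>) (\<lambda>s. (1 + s) powr (- (3 / 2)))"
  proof (rule interval_integral_FTC_nonneg(1))
    show "((\<lambda>s. - 2 * (1 + s) powr (- (1 / 2))) has_real_derivative (1 + s) powr (- (3 / 2))) (at s)"
      if "ereal 0 < ereal s" for s
      using that by (auto intro!: derivative_eq_intros)
    show "isCont (\<lambda>s. (1 + s) powr (- (3 / 2))) s" if "ereal 0 < ereal s" for s
      using that by (auto intro!: continuous_intros)
    have "((\<lambda>s. - 2 * (1 + s) powr (- (1 / 2))) \<longlongrightarrow> - 2) (at_right (0::real))"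
      by real_asymp
    then show "(((\<lambda>s. - 2 * (1 + s) powr (- (1 / 2))) \<circ> real_of_ereal) \<longlongrightarrow> - 2) (at_right (ereal 0))"
      by (simp add: ereal_tendsto_simps)
    have "((\<lambda>s. - 2 * (1 + s) powr (- (1 / 2))) \<longlongrightarrow> (0::real)) at_top"
      by real_asymp
    then show "(((\<lambda>s. - 2 * (1 + s) powr (- (1 / 2))) \<circ> real_of_ereal) \<longlongrightarrow> 0) (at_left \<infinity>)"
      by (simp add: ereal_tendsto_simps)
  qed auto
  then show ?thesis
    unfolding half_line_def set_integrable_def by (subst integrable_restrict_space) auto
qed

lemma has_bochner_integral_bessel_series:
  assumes "y > 0"
  shows "has_bochner_integral half_line (\<lambda>s. s / (1 + s)\<^sup>2 * bessel_series 1 (- (s * y))) (macdonald 1 y)"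
proof -
  define b where "b = (\<lambda>s. bessel_series 1 (- (s * y)))"
  have [measurable]: "b \<in> borel_measurable borel"
    unfolding b_def by measurable
  define f where "f = (\<lambda>s t. s * b s * (t ^ 1 * exp (- ((1 + s) * t))))"
  have [measurable]: "fst \<in> borel_measurable (half_line \<Otimes>\<^sub>M half_line)" "snd \<in> borel_measurable (half_line \<Otimes>\<^sub>M half_line)"
    using measurable_compose[OF measurable_fst measurable_half_line]
      measurable_compose[OF measurable_snd measurable_half_line] by auto
  have f_meas: "(\<lambda>p. f (fst p) (snd p)) \<in> borel_measurable (half_line \<Otimes>\<^sub>M half_line)"
    unfolding f_def by measurable
  have inner: "has_bochner_integral half_line (\<lambda>t. t ^ 1 * exp (- ((1 + s) * t))) (1 / (1 + s)\<^sup>2)" if "s > 0" for s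
    using has_bochner_integral_power_exp[of "1 + s" 1] that by (simp add: power2_eq_square)
  have int_t: "integrable half_line (f s)" "integral\<^sup>L half_line (f s) = s / (1 + s)\<^sup>2 * b s" if "s > 0" for s
    using inner[OF that] by (simp_all add: f_def has_bochner_integral_iff)
  have norm_t: "(\<integral>t. norm (f s t) \<partial>half_line) = \<bar>s / (1 + s)\<^sup>2 * b s\<bar>" if "s > 0" for s
  proof -
    have "(\<integral>t. norm (f s t) \<partial>half_line) = (\<integral>t. \<bar>s * b s\<bar> * (t ^ 1 * exp (- ((1 + s) * t))) \<partial>half_line)"
      by (rule Bochner_Integration.integral_cong) (auto simp: f_def abs_mult)
    then show ?thesis
      using inner[OF that] by (simp add: has_bochner_integral_iff abs_mult)
  qed
  \<comment> \<open>The decay s^(-1/2) of the Bessel factor is essential: s / (1 + s)^2 alone is not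
    integrable at infinity.\<close>
  have "\<bar>s / (1 + s)\<^sup>2 * b s\<bar> \<le> 1 / sqrt y * (1 + s) powr (- (3 / 2))" if "s > 0" for s
  proof -
    have "\<bar>s / (1 + s)\<^sup>2 * b s\<bar> \<le> s / (1 + s)\<^sup>2 * (1 / sqrt (s * y))"
      unfolding abs_mult b_def using that assms by (intro mult_mono abs_bessel_series_1_le) auto
    also have "\<dots> = 1 / sqrt y * (sqrt s / (1 + s)\<^sup>2)"
      using that assms by (simp add: real_sqrt_mult field_simps)
    also have "\<dots> \<le> 1 / sqrt y * (sqrt (1 + s) / (1 + s)\<^sup>2)"
      using that assms by (intro mult_left_mono divide_right_mono) auto
    also have "sqrt (1 + s) / (1 + s)\<^sup>2 = (1 + s) powr (1 / 2 - 2)"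
      using that by (subst powr_diff) (simp add: powr_half_sqrt powr_numeral)
    finally show ?thesis by simp
  qed
  then have "AE s in half_line. norm (s / (1 + s)\<^sup>2 * b s) \<le> norm (1 / sqrt y * (1 + s) powr (- (3 / 2)))"
    using assms by (intro AE_I2) auto
  moreover have "(\<lambda>s. s / (1 + s)\<^sup>2 * b s) \<in> borel_measurable half_line"
    by measurable
  ultimately have int_s: "integrable half_line (\<lambda>s. s / (1 + s)\<^sup>2 * b s)"
    by (intro Bochner_Integration.integrable_bound[OF integrable_mult_right[OF integrable_half_line_powr]])
  have "integrable (half_line \<Otimes>\<^sub>M half_line) (\<lambda>p. f (fst p) (snd p))"
  proof (rule half_line_pair.Fubini_integrable[OF f_meas])
    have "integrable half_line (\<lambda>s. \<bar>s / (1 + s)\<^sup>2 * b s\<bar>)"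
      using int_s by (rule integrable_abs)
    also have "?this \<longleftrightarrow> integrable half_line (\<lambda>s. \<integral>t. norm (f (fst (s, t)) (snd (s, t))) \<partial>half_line)"
      by (rule Bochner_Integration.integrable_cong) (use norm_t in auto)
    finally show "integrable half_line (\<lambda>s. \<integral>t. norm (f (fst (s, t)) (snd (s, t))) \<partial>half_line)" .
    show "AE s in half_line. integrable half_line (\<lambda>t. f (fst (s, t)) (snd (s, t)))"
      using int_t(1) by (intro AE_I2) simp
  qed
  then have "integrable (half_line \<Otimes>\<^sub>M half_line) (case_prod f)"
    by (simp add: case_prod_unfold)
  then have "(\<integral>t. \<integral>s. f s t \<partial>half_line \<partial>half_line) = (\<integral>s. \<integral>t. f s t \<partial>half_line \<partial>half_line)"
    by (rule half_line_pair.Fubini_integral)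
  also have "\<dots> = (\<integral>s. s / (1 + s)\<^sup>2 * b s \<partial>half_line)"
    by (rule Bochner_Integration.integral_cong) (use int_t(2) in auto)
  also have "(\<integral>t. \<integral>s. f s t \<partial>half_line \<partial>half_line) = macdonald 1 y"
    unfolding macdonald_def
  proof (rule Bochner_Integration.integral_cong)
    fix t assume "t \<in> space half_line"
    then have "t > 0" by simp
    have "f s t = t * exp (- t) * (s * exp (- (t * s)) * bessel_series 1 (- (s * y)))" for s
      by (simp add: f_def b_def exp_diff exp_minus distrib_right exp_add field_simps)
    then have "(\<integral>s. f s t \<partial>half_line) = t * exp (- t) * (exp (- (y / t)) / t\<^sup>2)"
      using laplace_bessel_series[OF \<open>t > 0\<close>, of y] by (simp add: has_bochner_integral_iff)
    also have "\<dots> = (1 / t) ^ 1 * (exp (- t) * exp (- (y / t)))"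
      using \<open>t > 0\<close> by (simp add: power2_eq_square)
    finally show "(\<integral>s. f s t \<partial>half_line) = (1 / t) ^ 1 * exp (- t - y / t)"
      by (simp only: mult_exp_exp) simp
  qed simp
  finally show ?thesis
    using int_s by (simp add: has_bochner_integral_iff b_def)
qed

text \<open>Under s = c^2 the Jacobian 2c supplies the factor missing in J_1(cx) = (c x / 2)
  \<open>bessel_series 1 (- (c * x / 2)\<^sup>2)\<close>; the quotient of c x / 2 by 2c is the
  constant x / 4.\<close>

lemma has_bochner_integral_bessel_j:
  assumes "x > 0"
  shows "has_bochner_integral half_line (\<lambda>c. c\<^sup>2 / (1 + c\<^sup>2)\<^sup>2 * bessel_j 1 (c * x)) (x / 4 * macdonald 1 ((x / 2)\<^sup>2))"
proof -
  let ?y = "(x / 2)\<^sup>2"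
  let ?f = "\<lambda>s. s / (1 + s)\<^sup>2 * bessel_series 1 (- (s * ?y))"
  have "has_bochner_integral half_line ?f (macdonald 1 ?y)"
    using assms by (intro has_bochner_integral_bessel_series) auto
  also have "?this \<longleftrightarrow> has_bochner_integral half_line (\<lambda>c. \<bar>2 * c\<bar> *\<^sub>R ?f (c\<^sup>2)) (macdonald 1 ?y)"
  proof (rule has_bochner_integral_half_line_substitution[symmetric])
    show "(\<lambda>c::real. c\<^sup>2) ` {0<..} = {0<..}"
    proof (intro equalityI subsetI)
      fix s :: real assume "s \<in> {0<..}"
      then show "s \<in> (\<lambda>c. c\<^sup>2) ` {0<..}"
        by (intro image_eqI[of _ _ "sqrt s"]) auto
    qed auto
    show "inj_on (\<lambda>c::real. c\<^sup>2) {0<..}"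
      by (auto intro!: inj_onI)
  qed (auto intro!: derivative_eq_intros)
  finally have "has_bochner_integral half_line (\<lambda>c. x / 4 * (\<bar>2 * c\<bar> *\<^sub>R ?f (c\<^sup>2))) (x / 4 * macdonald 1 ?y)"
    by (rule has_bochner_integral_mult_right)
  also have "?this \<longleftrightarrow> ?thesis"
    by (rule has_bochner_integral_cong) (auto simp: bessel_j_def power_divide power_mult_distrib mult_ac)
  finally show ?thesis .
qed

section \<open>Transfer to \<open>bessel_K\<close> and holomorphy on the slit plane\<close>

lemma digamma_series_of_real:
  "digamma_series (of_real y :: 'a::{real_normed_field,banach}) = of_real (digamma_series y)"
  unfolding digamma_series_def
  by (subst suminf_of_real[OF summable_digamma_series]) simp

text \<open>The factor 2 matches because ln ((x / 2)^2) = 2 ln (x / 2).\<close>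

lemma macdonald_1_conv_bessel_K:
  assumes "x > 0"
  shows "of_real (macdonald 1 ((x / 2)\<^sup>2)) = 2 * bessel_K 0 (of_real x)"
proof -
  have sq: "(of_real x / 2)\<^sup>2 = complex_of_real ((x / 2)\<^sup>2)" by simp
  have ln: "Ln (of_real x / 2) = complex_of_real (ln (x / 2))"
    using assms Ln_of_real[of "x / 2"] by simp
  have "bessel_K 0 (of_real x) = of_real (digamma_series ((x / 2)\<^sup>2) - ln (x / 2) * bessel_series 0 ((x / 2)\<^sup>2))"
    using assms bessel_K_0_conv_series[of "of_real x"]
    by (simp only: sq ln digamma_series_of_real bessel_series_of_real of_real_diff of_real_mult of_real_eq_0_iff)
  moreover have "macdonald 1 ((x / 2)\<^sup>2) =
      2 * (digamma_series ((x / 2)\<^sup>2) - ln (x / 2) * bessel_series 0 ((x / 2)\<^sup>2))"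
    using assms macdonald_1_conv_series[of "(x / 2)\<^sup>2"] ln_realpow[of "x / 2" 2] by simp
  ultimately show ?thesis
    by simp
qed

lemma bessel_integrand_real:
  assumes "x > 0"
  shows "bessel_integrand (of_real x) absolutely_integrable_on {0..}"
    and "integral {0..} (bessel_integrand (of_real x)) = of_real x / 2 * bessel_K 0 (of_real x)"
proof -
  let ?f = "\<lambda>c. c\<^sup>2 / (1 + c\<^sup>2)\<^sup>2 * bessel_j 1 (c * x)"
  have eq: "bessel_integrand (of_real x) = (\<lambda>c. of_real (?f c))"
    by (simp add: fun_eq_iff bessel_integrand_def bessel_J_1_conv_bessel_j bessel_j_of_real
        flip: of_real_mult del: One_nat_def of_real_divide)
  have "has_bochner_integral half_line (bessel_integrand (of_real x)) (of_real (x / 4 * macdonald 1 ((x / 2)\<^sup>2)))"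
    unfolding eq by (intro has_bochner_integral_of_real has_bochner_integral_bessel_j assms)
  moreover have "?f \<in> borel_measurable borel"
    unfolding bessel_j_def by measurable
  then have "bessel_integrand (of_real x) \<in> borel_measurable borel"
    unfolding eq by (rule measurable_compose[OF _ borel_measurable_of_real])
  ultimately have *: "bessel_integrand (of_real x) absolutely_integrable_on {0<..}"
    "integral {0<..} (bessel_integrand (of_real x)) = of_real (x / 4 * macdonald 1 ((x / 2)\<^sup>2))"
    by (simp_all add: has_bochner_integral_half_line_iff)
  show "bessel_integrand (of_real x) absolutely_integrable_on {0..}"
    using *(1) by (subst absolutely_integrable_spike_set_eq[of _ "{0<..}"]) (auto intro: negligible_subset[of "{0}"])
  have "integral {0..} (bessel_integrand (of_real x)) = integral {0<..} (bessel_integrand (of_real x))"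
    by (rule integral_spike_set) (auto intro: negligible_subset[of "{0}"])
  also have "\<dots> = of_real x / 4 * of_real (macdonald 1 ((x / 2)\<^sup>2))"
    using *(2) by simp
  also have "\<dots> = of_real x / 2 * bessel_K 0 (of_real x)"
    by (simp only: macdonald_1_conv_bessel_K[OF assms]) simp
  finally show "integral {0..} (bessel_integrand (of_real x)) = of_real x / 2 * bessel_K 0 (of_real x)" .
qed

text \<open>Defined as a limit in the order, \<open>bessel_K 0\<close> shows its holomorphy in z
  only through the logarithmic series, whose one non-entire ingredient is Ln (z / 2).\<close>

lemma holomorphic_on_bessel_K_0: "bessel_K 0 holomorphic_on (- \<real>\<^sub>\<le>\<^sub>0)"
proof -
  have "digamma_series holomorphic_on UNIV"
    unfolding holomorphic_on_open[OF open_UNIV] digamma_series_def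
    using termdiffs_strong_converges_everywhere[OF summable_digamma_series] by blast
  then have d: "digamma_series holomorphic_on A" for A
    by (rule holomorphic_on_subset) simp
  have "bessel_series 0 holomorphic_on UNIV"
    unfolding holomorphic_on_open[OF open_UNIV] using has_field_derivative_bessel_series by blast
  then have b: "bessel_series 0 holomorphic_on A" for A
    by (rule holomorphic_on_subset) simp
  have nz: "z / 2 \<notin> \<real>\<^sub>\<le>\<^sub>0" if "z \<notin> \<real>\<^sub>\<le>\<^sub>0" for z :: complex
    using that by (auto simp: complex_nonpos_Reals_iff)
  have sq: "(\<lambda>z::complex. (z / 2)\<^sup>2) holomorphic_on A" for A
    by (intro holomorphic_intros) auto
  have "(\<lambda>z. digamma_series ((z / 2)\<^sup>2) - Ln (z / 2) * bessel_series 0 ((z / 2)\<^sup>2)) holomorphic_on (- \<real>\<^sub>\<le>\<^sub>0)"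
    using holomorphic_on_compose_gen[OF sq d, of "- \<real>\<^sub>\<le>\<^sub>0" UNIV] holomorphic_on_compose_gen[OF sq b, of "- \<real>\<^sub>\<le>\<^sub>0" UNIV]
    by (intro holomorphic_intros) (auto simp: o_def nz)
  then show ?thesis
  proof (rule holomorphic_transform)
    fix z :: complex assume "z \<in> - \<real>\<^sub>\<le>\<^sub>0"
    then have "z \<noteq> 0" by auto
    then show "digamma_series ((z / 2)\<^sup>2) - Ln (z / 2) * bessel_series 0 ((z / 2)\<^sup>2) = bessel_K 0 z"
      by (simp add: bessel_K_0_conv_series)
  qed
qed

text \<open>Off the axis the integral diverges and \<open>integral\<close> takes its default value
  0, so the identity is expressed by absolute convergence for real z, equality whenever the integral
  exists, and equality for a holomorphic continuation F. The slit plane is connected, so F is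
  determined by its values on the positive axis.\<close>

theorem theorem6:
  fixes z :: complex
  assumes "z \<notin> \<real>\<^sub>\<le>\<^sub>0"
  shows "(z \<in> \<real> \<longrightarrow> bessel_integrand z absolutely_integrable_on {0..}) \<and>
    (bessel_integrand z integrable_on {0..} \<longrightarrow>
       integral {0..} (bessel_integrand z) = z / 2 * bessel_K 0 z) \<and>
    (\<exists>F. F holomorphic_on (- \<real>\<^sub>\<le>\<^sub>0) \<and>
       (\<forall>x>0. F (complex_of_real x) = integral {0..} (bessel_integrand (complex_of_real x))) \<and>
       F z = z / 2 * bessel_K 0 z)"
proof (intro conjI impI)
  have pos: "\<exists>x>0. z = of_real x" if "z \<in> \<real>"
    using assms that by (auto elim!: Reals_cases simp: not_le)
  show "bessel_integrand z absolutely_integrable_on {0..}" if "z \<in> \<real>"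
    using pos[OF that] bessel_integrand_real(1) by blast
  show "integral {0..} (bessel_integrand z) = z / 2 * bessel_K 0 z" if "bessel_integrand z integrable_on {0..}"
  proof -
    have "z \<in> \<real>"
      using not_integrable_bessel_integrand that by (auto simp: complex_is_Real_iff)
    then show ?thesis
      using pos bessel_integrand_real(2) by blast
  qed
  have "(\<lambda>w. w / 2 * bessel_K 0 w) holomorphic_on (- \<real>\<^sub>\<le>\<^sub>0)"
    by (intro holomorphic_intros holomorphic_on_bessel_K_0) auto
  then show "\<exists>F. F holomorphic_on (- \<real>\<^sub>\<le>\<^sub>0) \<and>
       (\<forall>x>0. F (complex_of_real x) = integral {0..} (bessel_integrand (complex_of_real x))) \<and>
       F z = z / 2 * bessel_K 0 z"
    using bessel_integrand_real(2) by (intro exI[of _ "\<lambda>w. w / 2 * bessel_K 0 w"]) auto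
qed

end
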